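(* Let $n\geqslant4$ be an integer and let $\alpha,\beta$ be real numbers satisfying one of: $-1<\alpha<0,\ -1<\beta$; or $0\leqslant\alpha<1,\ 0<\beta$; or $1\leqslant\alpha<2,\ 1<\beta$. Then the zeros of the polynomials $\phi_n^{(\alpha,\beta)}(\mu)$ and $\phi_{n-1}^{(\alpha,\beta)}(\mu)$ interlace (strictly).
   Context: For real $a$ and integer $m\geqslant0$, $(a)_m=a(a+1)\cdots(a+m-1)$, $(a)_0=1$. The Jacobi polynomial is $P_n^{(\alpha,\beta)}(x)=\frac{(\alpha+1)_n}{n!}\sum_{k=0}^{n}\frac{(-n)_k(n+\alpha+\beta+1)_k}{k!\,(\alpha+1)_k}\big(\frac{1-x}{2}\big)^k$, and $$\phi_n^{(\alpha,\beta)}(\mu)=\sum_{k=0}^{[n/2]}\Big(\tfrac{d^{2k}}{dx^{2k}}P_n^{(\alpha,\beta)}(x)\Big)\Big|_{x=1}\mu^k=\frac{(\alpha+1)_n}{n!}\sum_{k=0}^{[n/2]}\frac{(-n)_{2k}(n+\alpha+\beta+1)_{2k}}{(\alpha+1)_{2k}}\Big(\frac{\mu}{4}\Big)^k .$$ Two real polynomials interlace (strictly) if all their zeros are real, simple and mutually distinct, and between any two consecutive zeros of either polynomial there is exactly one zero of the other. *)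

theory Defs
  imports "HOL-Computational_Algebra.Polynomial" Complex_Main
begin

definition jacobi_phi :: "real \<Rightarrow> real \<Rightarrow> nat \<Rightarrow> real poly" where
  "jacobi_phi \<alpha> \<beta> n =
     smult (pochhammer (\<alpha> + 1) n / fact n)
       (\<Sum>k\<le>n div 2. monom (pochhammer (- real n) (2*k) * pochhammer (real n + \<alpha> + \<beta> + 1) (2*k)
                              / pochhammer (\<alpha> + 1) (2*k) / 4 ^ k) k)"

definition all_zeros_real_simple :: "real poly \<Rightarrow> bool" where
  "all_zeros_real_simple p \<longleftrightarrow> p \<noteq> 0 \<and>
     (\<forall>z::complex. poly (map_poly complex_of_real p) z = 0 \<longrightarrow> z \<in> \<real>) \<and>
     rsquarefree (map_poly complex_of_real p)"

definition consecutive_zeros :: "real poly \<Rightarrow> real \<Rightarrow> real \<Rightarrow> bool" where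
  "consecutive_zeros p x y \<longleftrightarrow> x < y \<and> poly p x = 0 \<and> poly p y = 0 \<and>
     (\<forall>z. x < z \<and> z < y \<longrightarrow> poly p z \<noteq> 0)"

definition strictly_interlace :: "real poly \<Rightarrow> real poly \<Rightarrow> bool" where
  "strictly_interlace p q \<longleftrightarrow>
     all_zeros_real_simple p \<and> all_zeros_real_simple q \<and>
     (\<forall>x. \<not> (poly p x = 0 \<and> poly q x = 0)) \<and>
     (\<forall>x y. consecutive_zeros p x y \<longrightarrow> card {z. x < z \<and> z < y \<and> poly q z = 0} = 1) \<and>
     (\<forall>x y. consecutive_zeros q x y \<longrightarrow> card {z. x < z \<and> z < y \<and> poly p z = 0} = 1)"

end

theory Submission
  imports
    Defs
    "HOL-Analysis.Gamma_Function"
    "HOL-Computational_Algebra.Formal_Power_Series"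
    "HOL-Computational_Algebra.Fundamental_Theorem_Algebra"
begin

text \<open>
  Let \<open>\<theta> = \<mu> d/d\<mu>\<close>. Up to constant factors, \<open>\<phi>_n^(\<alpha>,\<beta>)\<close> is \<open>(n + \<alpha> + \<beta> + 2\<theta>) h\<close> and
  \<open>\<phi>_(n-1)^(\<alpha>,\<beta>)\<close> is \<open>(n - 2\<theta>) h\<close> with the same \<open>h = \<phi>_n^(\<alpha>,\<beta>-1)\<close>. If all zeros of \<open>h\<close> are negative
  and simple, then any two independent combinations of \<open>h\<close> and \<open>\<theta> h\<close> that both involve \<open>\<theta> h\<close>
  interlace, because \<open>Im (\<theta>h/h)\<close> does not vanish off the real axis and
  \<open>h (\<theta>h)' - h' (\<theta>h) > 0\<close> on it.

  The zeros of \<open>h\<close> are controlled by the Hermite-Biehler theorem: \<open>h\<close> is the even part of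
  \<open>F(s) = \<Sum> P_n^(j)(1) s^j\<close> with parameters \<open>(\<alpha>, \<beta>-1)\<close> and, up to a factor, the odd part of the
  same sum with degree \<open>n+1\<close> and parameters \<open>(\<alpha>-1, \<beta>-2)\<close>. If \<open>F(s) = 0\<close>, then
  \<open>u = \<Sum> s^j P_n^(j)\<close> solves \<open>u - s u' = P_n\<close> and vanishes at \<open>1\<close>. Testing this equation
  against a polynomial built from \<open>u\<close>, with a Jacobi weight for which \<open>P_n\<close> is orthogonal to nearly
  the whole test function, and taking real parts excludes \<open>Re s \<ge> 0\<close>.
\<close>

section \<open>Moments of the beta distribution\<close>

text \<open>
  \<open>beta_moment a b f\<close> is the integral of \<open>f(t) t^(a-1) (1-t)^(b-1)\<close> over \<open>[0,1]\<close>. Defining it on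
  monomials by the Beta function reduces integration by parts to recurrences of \<open>Beta\<close>; the integral
  itself is only used for positivity.
\<close>

definition beta_moment :: "real \<Rightarrow> real \<Rightarrow> real poly \<Rightarrow> real" where
  "beta_moment a b f = (\<Sum>k\<le>degree f. coeff f k * Beta (a + real k) b)"

section \<open>Linearity of moments and their shift rules\<close>

lemma beta_moment_altdef:
  assumes "degree f \<le> n"
  shows "beta_moment a b f = (\<Sum>k\<le>n. coeff f k * Beta (a + real k) b)"
  unfolding beta_moment_def
  by (rule sum.mono_neutral_left) (use assms in \<open>auto simp: coeff_eq_0\<close>)

lemma beta_moment_0 [simp]: "beta_moment a b 0 = 0"
  by (simp add: beta_moment_def)

lemma beta_moment_add: "beta_moment a b (f + g) = beta_moment a b f + beta_moment a b g"
  by (simp add: beta_moment_altdef[of _ "max (degree f) (degree g)"] degree_add_le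
      sum.distrib ring_distribs)

lemma beta_moment_smult: "beta_moment a b (smult c f) = c * beta_moment a b f"
  by (simp add: beta_moment_altdef[of _ "degree f"] sum_distrib_left mult_ac)

lemma beta_moment_minus: "beta_moment a b (- f) = - beta_moment a b f"
  using beta_moment_smult[of a b "-1" f] by simp

lemma beta_moment_diff: "beta_moment a b (f - g) = beta_moment a b f - beta_moment a b g"
  using beta_moment_add[of a b f "- g"] by (simp add: beta_moment_minus)

lemma beta_moment_monom: "beta_moment a b (monom c k) = c * Beta (a + real k) b"
  by (subst beta_moment_altdef[of _ k])
     (auto simp: degree_monom_le coeff_monom if_distrib[of "\<lambda>x. x * _"] cong: if_cong)

lemma beta_moment_sum: "beta_moment a b (\<Sum>i\<in>A. f i) = (\<Sum>i\<in>A. beta_moment a b (f i))"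
  by (induction A rule: infinite_finite_induct) (auto simp: beta_moment_add)

text \<open>Reduces the moment identities that follow to monomials, where they become recurrences of
  \<open>Beta\<close>.\<close>

lemma poly_linear_eqI:
  fixes f g :: "real poly \<Rightarrow> real"
  assumes "\<And>p q. f (p + q) = f p + f q" "\<And>p q. g (p + q) = g p + g q"
    and "\<And>c k. f (monom c k) = g (monom c k)"
  shows "f p = g p"
proof -
  have 0: "f 0 = 0" "g 0 = 0"
    using assms(1)[of 0 0] assms(2)[of 0 0] by auto
  have s: "f (\<Sum>i\<in>A. h i) = (\<Sum>i\<in>A. f (h i))" "g (\<Sum>i\<in>A. h i) = (\<Sum>i\<in>A. g (h i))"
    for A :: "nat set" and h
    by (induction A rule: infinite_finite_induct) (auto simp: 0 assms(1,2))
  show ?thesis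
    by (subst (1 2) poly_as_sum_of_monoms[symmetric]) (simp add: s assms(3))
qed

lemma pos_notin_nonpos_Ints: "(x::real) > 0 \<Longrightarrow> x \<notin> \<int>\<^sub>\<le>\<^sub>0"
  by (auto elim!: nonpos_Ints_cases)

lemma beta_moment_X: "beta_moment a b (pCons 0 f) = beta_moment (a + 1) b f"
proof (rule poly_linear_eqI[where p = f])
  fix p q :: "real poly"
  have "pCons 0 (p + q) = pCons 0 p + pCons 0 q" by simp
  then show "beta_moment a b (pCons 0 (p + q)) = beta_moment a b (pCons 0 p) + beta_moment a b (pCons 0 q)"
    by (metis beta_moment_add)
next
  fix c :: real and k :: nat
  show "beta_moment a b (pCons 0 (monom c k)) = beta_moment (a + 1) b (monom c k)"
    by (simp add: beta_moment_monom add_ac flip: monom_Suc)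
qed (rule beta_moment_add)

text \<open>The factor 1 - t is absorbed into the weight; on monomials this is
  \<open>Beta (a + 1) b + Beta a (b + 1) = Beta a b\<close>.\<close>

lemma beta_moment_one_minus_X:
  assumes "a > 0" "b > 0"
  shows "beta_moment a b ([:1, -1:] * f) = beta_moment a (b + 1) f"
proof (rule poly_linear_eqI[where p = f])
  fix c :: real and k :: nat
  have "Beta (a + real k + 1) b + Beta (a + real k) (b + 1) = Beta (a + real k) b"
    using assms by (intro Beta_plus1_plus1 pos_notin_nonpos_Ints) auto
  moreover
  have "[:1, -1:] * monom c k = monom c k - monom c (Suc k)"
    by (simp add: monom_Suc smult_monom minus_monom)
  then have "beta_moment a b ([:1, -1:] * monom c k) =
      c * (Beta (a + real k) b - Beta (a + real k + 1) b)"
    by (simp only: beta_moment_diff beta_moment_monom) (simp add: algebra_simps)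
  ultimately show "beta_moment a b ([:1, -1:] * monom c k) = beta_moment a (b + 1) (monom c k)"
    by (simp add: beta_moment_monom)
qed (auto simp: ring_distribs beta_moment_add simp del: mult_pCons_left)

lemma beta_moment_one_minus_X_power:
  assumes "a > 0" "b > 0"
  shows "beta_moment a b ([:1, -1:] ^ m * f) = beta_moment a (b + real m) f"
  using assms
proof (induction m arbitrary: b)
  case (Suc m)
  have "beta_moment a b ([:1, -1:] ^ Suc m * f) = beta_moment a b ([:1, -1:] * ([:1, -1:] ^ m * f))"
    by (simp add: mult_ac del: mult_pCons_left mult_pCons_right)
  also have "\<dots> = beta_moment a (b + 1) ([:1, -1:] ^ m * f)"
    using Suc.prems by (rule beta_moment_one_minus_X)
  also have "\<dots> = beta_moment a (b + 1 + real m) f"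
    using Suc.prems by (intro Suc.IH) auto
  finally show ?case by (simp add: add_ac)
qed simp

text \<open>Integration by parts against the weight t^a (1-t)^b, whose boundary terms vanish for
  positive \<open>a\<close> and \<open>b\<close>.\<close>

lemma beta_moment_pderiv:
  assumes "a > 0" "b > 0"
  shows "beta_moment (a + 1) (b + 1) (pderiv f) =
    b * beta_moment (a + 1) b f - a * beta_moment a (b + 1) f"
proof (rule poly_linear_eqI[where p = f])
  fix c :: real and k :: nat
  have key: "M = b * (c * B) - a * (c * X)"
    if "b * B = (a + real k) * X" "M = c * (real k * X)" for M B X
  proof -
    have "b * (c * B) - a * (c * X) = c * (b * B) - c * (a * X)" by simp
    then show ?thesis by (simp only: that) (simp add: algebra_simps)
  qed
  have ab: "a + real k \<notin> \<int>\<^sub>\<le>\<^sub>0" "b \<notin> \<int>\<^sub>\<le>\<^sub>0"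
    using assms by (auto intro!: pos_notin_nonpos_Ints)
  have 1: "(a + real k + b) * Beta (a + real k + 1) b = (a + real k) * Beta (a + real k) b"
    using Beta_plus1_left[OF ab(1), of b] by simp
  have 2: "(a + real k + b) * Beta (a + real k) (b + 1) = b * Beta (a + real k) b"
    using Beta_plus1_right[OF ab(2), of "a + real k"] by simp
  have "(a + real k + b) * (b * Beta (a + real k + 1) b) =
        (a + real k + b) * ((a + real k) * Beta (a + real k) (b + 1))"
    using 1 2 by (metis mult.left_commute)
  moreover have "a + real k + b > 0"
    using assms by simp
  ultimately have "b * Beta (a + real k + 1) b = (a + real k) * Beta (a + real k) (b + 1)"
    by (metis mult_left_cancel less_irrefl)
  \<comment> \<open>The factor \<open>real k\<close> makes the truncated \<open>k - 1\<close>
    harmless at k = 0.\<close>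
  moreover have "real k * Beta (a + 1 + real (k - 1)) (b + 1) = real k * Beta (a + real k) (b + 1)"
    by (cases k) (auto simp: add_ac)
  moreover have "beta_moment (a + 1) (b + 1) (pderiv (monom c k)) =
      c * (real k * Beta (a + 1 + real (k - 1)) (b + 1))"
    by (simp add: pderiv_monom beta_moment_monom)
  moreover have "a + 1 + real k = a + real k + 1" by simp
  ultimately show "beta_moment (a + 1) (b + 1) (pderiv (monom c k)) =
      b * beta_moment (a + 1) b (monom c k) - a * beta_moment a (b + 1) (monom c k)"
    unfolding beta_moment_monom using key by (simp only:)
qed (auto simp: pderiv_add beta_moment_add ring_distribs)

section \<open>Positivity of moments\<close>

lemma has_integral_beta_moment:
  assumes "a > 0" "b > 0"
  shows "((\<lambda>t. poly f t * (t powr (a - 1) * (1 - t) powr (b - 1))) has_integral beta_moment a b f) {0..1}"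
proof -
  have "((\<lambda>t. \<Sum>k\<le>degree f. coeff f k * (t powr (a + real k - 1) * (1 - t) powr (b - 1)))
      has_integral beta_moment a b f) {0..1}"
    unfolding beta_moment_def using assms
    by (intro has_integral_sum has_integral_mult_right has_integral_Beta_real) auto
  \<comment> \<open>The point 0 is left out because rewriting \<open>t powr real k\<close> as
    \<open>t ^ k\<close> uses t > 0.\<close>
  then show ?thesis
  proof (rule has_integral_spike_finite[of "{0}", rotated 2])
    fix t :: real assume "t \<in> {0..1} - {0}"
    then have "t powr (a + real k - 1) = t ^ k * t powr (a - 1)" for k
      using powr_add[of t "real k" "a - 1"] by (simp add: powr_realpow add_ac algebra_simps)
    then show "poly f t * (t powr (a - 1) * (1 - t) powr (b - 1)) =
      (\<Sum>k\<le>degree f. coeff f k * (t powr (a + real k - 1) * (1 - t) powr (b - 1)))"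
      by (simp add: poly_altdef sum_distrib_left sum_distrib_right mult_ac)
  qed auto
qed

lemma beta_moment_nonneg:
  assumes "a > 0" "b > 0" "\<And>x. x \<in> {0..1} \<Longrightarrow> poly f x \<ge> 0"
  shows "beta_moment a b f \<ge> 0"
  by (rule has_integral_nonneg[OF has_integral_beta_moment[OF assms(1,2)]]) (use assms in auto)

text \<open>If the moment were zero, the nonnegative integrand would vanish on a subinterval where
  the weight is positive, and \<open>f\<close> would have infinitely many zeros.\<close>

lemma beta_moment_pos:
  assumes "a > 0" "b > 0" "\<And>x. x \<in> {0..1} \<Longrightarrow> poly f x \<ge> 0" "f \<noteq> 0"
  shows "beta_moment a b f > 0"
proof (rule ccontr)
  let ?w = "\<lambda>t. poly f t * (t powr (a - 1) * (1 - t) powr (b - 1))"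
  \<comment> \<open>Staying away from 0 and 1 keeps the weight continuous even for
    \<open>a < 1\<close> or \<open>b < 1\<close>.\<close>
  let ?I = "cbox (1/4) (3/4) :: real set"
  assume "\<not> beta_moment a b f > 0"
  then have "beta_moment a b f = 0"
    using beta_moment_nonneg[of a b f] assms by force
  then have int: "(?w has_integral 0) {0..1}"
    using has_integral_beta_moment[of a b f] assms by simp
  have w: "?w t \<ge> 0" if "t \<in> {0..1}" for t
    using that assms by auto
  have on_I: "?w integrable_on ?I"
    by (rule integrable_on_subcbox[of _ "{0..1}"]) (use int in auto)
  have "integral ?I ?w \<le> integral {0..1} ?w"
    by (rule integral_subset_le) (use int w on_I in auto)
  moreover have "integral ?I ?w \<ge> 0"
    by (rule integral_nonneg) (use w on_I in auto)
  ultimately have "integral ?I ?w = 0"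
    using int by (simp add: integral_unique)
  then have 0: "(?w has_integral 0) ?I"
    using on_I by (simp add: has_integral_iff)
  have "poly f t = 0" if "t \<in> ?I" for t
  proof -
    have "?w t = 0"
      by (rule has_integral_0_cbox_imp_0[OF _ _ 0 _ that])
         (use w in \<open>auto intro!: continuous_intros\<close>)
    then show ?thesis using that by auto
  qed
  then have "?I \<subseteq> {t. poly f t = 0}" by blast
  moreover have "infinite ?I" by (simp add: infinite_Icc)
  ultimately have "infinite {t. poly f t = 0}"
    using infinite_super by blast
  with \<open>f \<noteq> 0\<close> show False
    using poly_roots_finite by blast
qed

lemma Beta_real_pos: "a > 0 \<Longrightarrow> b > 0 \<Longrightarrow> Beta a (b::real) > 0"
  by (simp add: Beta_def)

lemma Beta_pochhammer_left:
  fixes a b :: real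
  assumes "a > 0" "b > 0"
  shows "Beta (a + real k) b = Beta a b * pochhammer a k / pochhammer (a + b) k"
proof (induction k)
  case (Suc k)
  have "(a + real k + b) * Beta (a + real k + 1) b = (a + real k) * Beta (a + real k) b"
    using assms by (intro Beta_plus1_left pos_notin_nonpos_Ints) auto
  moreover have "a + b + real k > 0" using assms by simp
  moreover have "a + real (Suc k) = a + real k + 1" by simp
  ultimately have "Beta (a + real (Suc k)) b = (a + real k) / (a + b + real k) * Beta (a + real k) b"
    by (simp only: eq_divide_eq times_divide_eq_left) (simp add: algebra_simps)
  then show ?case
    by (simp add: Suc.IH pochhammer_Suc mult_ac)
qed simp


section \<open>Orthogonality of Jacobi polynomials\<close>

text \<open>
  \<open>jacobi_poly\<close> is the Jacobi polynomial in the variable \<open>t = (1 - x)/2\<close>, normalised to the value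
  \<open>1\<close> at \<open>t = 0\<close>; \<open>jacobi_coeff\<close> is its \<open>j\<close>-th derivative there. Since \<open>d/dx\<close> becomes
  \<open>- 1/2 d/dt\<close>, the variable \<open>s\<close> of the generating polynomial turns into \<open>\<tau> = - s/2\<close>.
\<close>

definition jacobi_coeff :: "real \<Rightarrow> real \<Rightarrow> nat \<Rightarrow> nat \<Rightarrow> real" where
  "jacobi_coeff \<alpha> \<beta> n j =
     pochhammer (- real n) j * pochhammer (real n + \<alpha> + \<beta> + 1) j / pochhammer (\<alpha> + 1) j"

definition jacobi_poly :: "real \<Rightarrow> real \<Rightarrow> nat \<Rightarrow> real poly" where
  "jacobi_poly \<alpha> \<beta> n = (\<Sum>k\<le>n. monom (jacobi_coeff \<alpha> \<beta> n k / fact k) k)"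

lemma coeff_jacobi_poly:
  "coeff (jacobi_poly \<alpha> \<beta> n) k = (if k \<le> n then jacobi_coeff \<alpha> \<beta> n k / fact k else 0)"
  by (auto simp: jacobi_poly_def coeff_sum coeff_monom)

lemma degree_jacobi_poly_le: "degree (jacobi_poly \<alpha> \<beta> n) \<le> n"
  by (rule degree_le) (auto simp: coeff_jacobi_poly)

lemma pochhammer_minus_nat_pos:
  assumes "j \<le> n"
  shows "(- 1) ^ j * pochhammer (- real n) j > 0"
  using assms
proof (induction j)
  case (Suc j)
  have "(- 1) ^ Suc j * pochhammer (- real n) (Suc j) =
      (real n - real j) * ((- 1) ^ j * pochhammer (- real n) j)"
    by (simp add: pochhammer_Suc algebra_simps)
  then show ?case using Suc by simp
qed simp

text \<open>Only the factor \<open>pochhammer (- real n) j\<close> carries a sign.\<close>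

lemma jacobi_coeff_pos:
  assumes "\<alpha> > -1" "real n + \<alpha> + \<beta> + 1 > 0" "j \<le> n"
  shows "(- 1) ^ j * jacobi_coeff \<alpha> \<beta> n j > 0"
proof -
  have "(- 1) ^ j * jacobi_coeff \<alpha> \<beta> n j = ((- 1) ^ j * pochhammer (- real n) j) *
     pochhammer (real n + \<alpha> + \<beta> + 1) j / pochhammer (\<alpha> + 1) j"
    by (simp add: jacobi_coeff_def)
  then show ?thesis
    using pochhammer_minus_nat_pos[OF assms(3)] assms(1,2)
    by (simp add: pochhammer_pos)
qed

text \<open>Since \<open>pochhammer (\<alpha> + 1) k\<close> cancels, the moment is a terminating
  Gauss sum at 1, which Chu-Vandermonde evaluates. Orthogonality will come from the zeros of
  \<open>pochhammer (b - \<beta> - real n) n\<close>.\<close>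

lemma beta_moment_jacobi_poly:
  assumes "\<alpha> > -1" "b > 0"
  shows "beta_moment (\<alpha> + 1) b (jacobi_poly \<alpha> \<beta> n) =
    Beta (\<alpha> + 1) b * pochhammer (b - \<beta> - real n) n / pochhammer (\<alpha> + 1 + b) n"
proof -
  let ?N = "real n + \<alpha> + \<beta> + 1"
  have nz: "pochhammer (\<alpha> + 1) k > 0" for k
    using assms by (simp add: pochhammer_pos)
  have "beta_moment (\<alpha> + 1) b (jacobi_poly \<alpha> \<beta> n) =
      (\<Sum>k\<le>n. jacobi_coeff \<alpha> \<beta> n k / fact k * Beta (\<alpha> + 1 + real k) b)"
    by (simp add: jacobi_poly_def beta_moment_sum beta_moment_monom)
  also have "\<dots> = (\<Sum>k\<le>n. Beta (\<alpha> + 1) b * (pochhammer ?N k * pochhammer (- real n) k /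
      (fact k * pochhammer (\<alpha> + 1 + b) k)))"
  proof (rule sum.cong)
    fix k
    show "jacobi_coeff \<alpha> \<beta> n k / fact k * Beta (\<alpha> + 1 + real k) b =
      Beta (\<alpha> + 1) b * (pochhammer ?N k * pochhammer (- real n) k / (fact k * pochhammer (\<alpha> + 1 + b) k))"
      using nz[of k] assms by (simp add: Beta_pochhammer_left jacobi_coeff_def)
  qed auto
  also have "\<dots> = Beta (\<alpha> + 1) b * (\<Sum>k=0..n. pochhammer ?N k * pochhammer (- real n) k /
      (of_nat (fact k) * pochhammer (\<alpha> + 1 + b) k))"
    by (simp add: sum_distrib_left atMost_atLeast0)
  also have "(\<Sum>k=0..n. pochhammer ?N k * pochhammer (- real n) k /
      (of_nat (fact k) * pochhammer (\<alpha> + 1 + b) k)) =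
      pochhammer (\<alpha> + 1 + b - ?N) n / pochhammer (\<alpha> + 1 + b) n"
    using assms by (intro Vandermonde_pochhammer) auto
  also have "\<alpha> + 1 + b - ?N = b - \<beta> - real n" by simp
  finally show ?thesis by simp
qed

text \<open>The factor with index n - m - 1 is zero.\<close>

lemma pochhammer_neg_int_eq_0: "m < n \<Longrightarrow> pochhammer (real m + 1 - real n) n = 0"
  by (auto simp: pochhammer_eq_0_iff intro!: exI[of _ "n - m - 1"])

lemma pochhammer_two: "pochhammer (2 :: real) n = (real n + 1) * fact n"
  using pochhammer_rec[of "1::real" n] by (simp add: pochhammer_fact[symmetric] add.commute)

text \<open>\<open>d\<close> counts the surplus exponent of 1 - t in the weight; it shortens the
  range of orthogonality by as many degrees.\<close>

lemma jacobi_poly_orthogonal: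
  assumes "\<alpha> > -1" "\<beta> + real d > -1" "m + d < n"
  shows "beta_moment (\<alpha> + 1) (\<beta> + real d + 1) (jacobi_poly \<alpha> \<beta> n * [:1, -1:] ^ m) = 0"
proof -
  have "beta_moment (\<alpha> + 1) (\<beta> + real d + 1) ([:1, -1:] ^ m * jacobi_poly \<alpha> \<beta> n) =
      beta_moment (\<alpha> + 1) (\<beta> + real d + 1 + real m) (jacobi_poly \<alpha> \<beta> n)"
    using assms by (intro beta_moment_one_minus_X_power) auto
  also have "\<dots> = 0"
    using assms pochhammer_neg_int_eq_0[of "m + d" n]
    by (subst beta_moment_jacobi_poly) (auto simp: algebra_simps)
  finally show ?thesis by (simp only: mult.commute)
qed

text \<open>One step of the expansion in powers of 1 - t, the basis in which moments of Jacobi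
  polynomials are known.\<close>

lemma degree_minus_top_one_minus_X_power:
  fixes q :: "real poly"
  assumes "degree q \<le> Suc m"
  shows "degree (q - smult ((- 1) ^ Suc m * coeff q (Suc m)) ([:1, -1:] ^ Suc m)) \<le> m" (is "degree ?r \<le> m")
proof (rule degree_le, intro allI impI)
  fix i assume "m < i"
  show "coeff ?r i = 0"
  proof (cases "i = Suc m")
    case True
    then show ?thesis
      by (simp only: coeff_diff coeff_smult coeff_linear_poly_power[OF order.refl])
         (simp add: power_mult_distrib[symmetric])
  next
    case False
    have "degree ([:1, -1:] ^ Suc m :: real poly) = Suc m"
      by (simp add: degree_power_eq del: power_Suc)
    with False \<open>m < i\<close> assms show ?thesis
      by (simp add: coeff_eq_0 del: power_Suc)
  qed
qed

lemma jacobi_poly_orthogonal_degree: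
  assumes "\<alpha> > -1" "\<beta> + real d > -1" "degree q + d < n"
  shows "beta_moment (\<alpha> + 1) (\<beta> + real d + 1) (jacobi_poly \<alpha> \<beta> n * q) = 0"
proof -
  have "beta_moment (\<alpha> + 1) (\<beta> + real d + 1) (jacobi_poly \<alpha> \<beta> n * q) = 0"
    if "degree q \<le> m" "m + d < n" for m
    using that
  proof (induction m arbitrary: q)
    case 0
    then obtain c where "q = [:c:]" by (metis degree_eq_zeroE le_zero_eq)
    then have "q = smult c ([:1, -1:] ^ 0)" by simp
    then show ?case
      using jacobi_poly_orthogonal[OF assms(1,2), of 0 n] 0
      by (simp only: mult_smult_right beta_moment_smult)
  next
    case (Suc m)
    define c where "c = (- 1) ^ Suc m * coeff q (Suc m)"
    have "q = (q - smult c ([:1, -1:] ^ Suc m)) + smult c ([:1, -1:] ^ Suc m)" by simp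
    then have "beta_moment (\<alpha> + 1) (\<beta> + real d + 1) (jacobi_poly \<alpha> \<beta> n * q) =
        beta_moment (\<alpha> + 1) (\<beta> + real d + 1) (jacobi_poly \<alpha> \<beta> n * (q - smult c ([:1, -1:] ^ Suc m)))
      + c * beta_moment (\<alpha> + 1) (\<beta> + real d + 1) (jacobi_poly \<alpha> \<beta> n * [:1, -1:] ^ Suc m)"
      by (metis beta_moment_add beta_moment_smult distrib_left mult_smult_right)
    also have "\<dots> = 0"
      using Suc.IH[of "q - smult c ([:1, -1:] ^ Suc m)"] degree_minus_top_one_minus_X_power[OF Suc.prems(1)]
        jacobi_poly_orthogonal[OF assms(1,2) Suc.prems(2)] Suc.prems
      by (simp add: c_def del: power_Suc)
    finally show ?case .
  qed
  from this[of "degree q"] assms show ?thesis by simp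
qed

text \<open>In the first degree beyond orthogonality, \<open>q\<close> may be replaced by the
  multiple of (1-t)^m with the same top coefficient.\<close>

lemma beta_moment_jacobi_poly_top:
  assumes "\<alpha> > -1" "\<beta> + real d > -1" "degree q \<le> m" "m + d = n"
  shows "beta_moment (\<alpha> + 1) (\<beta> + real d + 1) (jacobi_poly \<alpha> \<beta> n * q) =
    (- 1) ^ m * coeff q m *
      beta_moment (\<alpha> + 1) (\<beta> + real n + 1) (jacobi_poly \<alpha> \<beta> n)"
proof -
  define c where "c = (- 1) ^ m * coeff q m"
  define r where "r = q - smult c ([:1, -1:] ^ m)"
  \<comment> \<open>For m = 0 the remainder is the zero polynomial, which a degree bound cannot
    express.\<close>
  have r0: "beta_moment (\<alpha> + 1) (\<beta> + real d + 1) (jacobi_poly \<alpha> \<beta> n * r) = 0"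
  proof (cases m)
    case 0
    then have "r = 0"
      using assms by (auto simp: r_def c_def elim: degree_eq_zeroE)
    then show ?thesis by simp
  next
    case (Suc k)
    show ?thesis
      using degree_minus_top_one_minus_X_power[of q k] assms Suc
      by (intro jacobi_poly_orthogonal_degree) (auto simp: r_def c_def simp del: power_Suc)
  qed
  have "q = r + smult c ([:1, -1:] ^ m)" by (simp add: r_def)
  then have "beta_moment (\<alpha> + 1) (\<beta> + real d + 1) (jacobi_poly \<alpha> \<beta> n * q) =
      beta_moment (\<alpha> + 1) (\<beta> + real d + 1) (jacobi_poly \<alpha> \<beta> n * r)
    + c * beta_moment (\<alpha> + 1) (\<beta> + real d + 1) ([:1, -1:] ^ m * jacobi_poly \<alpha> \<beta> n)"
    by (metis beta_moment_add beta_moment_smult distrib_left mult_smult_right mult.commute)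
  also have "beta_moment (\<alpha> + 1) (\<beta> + real d + 1) ([:1, -1:] ^ m * jacobi_poly \<alpha> \<beta> n) =
      beta_moment (\<alpha> + 1) (\<beta> + real d + 1 + real m) (jacobi_poly \<alpha> \<beta> n)"
    using assms by (intro beta_moment_one_minus_X_power) auto
  also have "\<beta> + real d + 1 + real m = \<beta> + real n + 1" using assms(4) by auto
  finally show ?thesis by (simp add: r0 c_def)
qed


section \<open>Hurwitz stability\<close>

text \<open>The pair is the real and imaginary part of the finite Neumann series of (1 - \<tau>
  d/dt)^(-1) applied to \<open>p\<close>. They are kept apart because \<open>beta_moment\<close>
  acts on real polynomials.\<close>

lemma resolvent_pair:
  fixes p :: "real poly" and \<tau> :: complex
  assumes "degree p \<le> n"
  obtains u v where
    "u = p + smult (Re \<tau>) (pderiv u) - smult (Im \<tau>) (pderiv v)"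
    "v = smult (Re \<tau>) (pderiv v) + smult (Im \<tau>) (pderiv u)"
    "degree u \<le> n" "degree v \<le> n"
    "Complex (poly u 0) (poly v 0) = (\<Sum>j\<le>n. \<tau> ^ j * of_real (fact j * coeff p j))"
proof
  define D where "D = (\<lambda>j. (pderiv ^^ j) p)"
  define u where "u = (\<Sum>j\<le>n. smult (Re (\<tau> ^ j)) (D j))"
  define v where "v = (\<Sum>j\<le>n. smult (Im (\<tau> ^ j)) (D j))"
  have D0: "D 0 = p" and DSuc: "pderiv (D j) = D (Suc j)" for j
    by (auto simp: D_def)
  \<comment> \<open>This ends the series, so that the index shift below is exact.\<close>
  have Dn: "D (Suc n) = 0"
    by (rule poly_eqI) (use assms in \<open>auto simp: D_def coeff_higher_pderiv coeff_eq_0 simp del: funpow.simps\<close>)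
  have pderiv_sum: "pderiv (\<Sum>j\<le>n. f j) = (\<Sum>j\<le>n. pderiv (f j))" for f :: "nat \<Rightarrow> real poly"
    using higher_pderiv_sum[of 1 f] by simp
  have smult_sum_right: "smult c (\<Sum>j\<le>n. f j) = (\<Sum>j\<le>n. smult c (f j))" for c :: real and f :: "nat \<Rightarrow> real poly"
    by (rule poly_eqI) (simp add: coeff_sum sum_distrib_left)
  have pu: "pderiv u = (\<Sum>j\<le>n. smult (Re (\<tau> ^ j)) (D (Suc j)))"
    and pv: "pderiv v = (\<Sum>j\<le>n. smult (Im (\<tau> ^ j)) (D (Suc j)))"
    by (auto simp: u_def v_def pderiv_sum pderiv_smult DSuc)
  have shift: "(\<Sum>j\<le>n. smult (f (Suc j)) (D (Suc j))) = (\<Sum>j\<le>n. smult (f j) (D j)) - smult (f 0) p" for f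
  proof -
    have "(\<Sum>j\<le>Suc n. smult (f j) (D j)) = smult (f 0) p + (\<Sum>j\<le>n. smult (f (Suc j)) (D (Suc j)))"
      by (subst sum.atMost_Suc_shift) (simp add: D0)
    then show ?thesis by (simp add: Dn)
  qed
  show "u = p + smult (Re \<tau>) (pderiv u) - smult (Im \<tau>) (pderiv v)"
  proof -
    have "smult (Re \<tau>) (pderiv u) - smult (Im \<tau>) (pderiv v) =
        (\<Sum>j\<le>n. smult (Re (\<tau> ^ Suc j)) (D (Suc j)))"
      by (simp add: pu pv smult_sum_right smult_diff_left sum_subtractf)
    then show ?thesis
      using shift[of "\<lambda>j. Re (\<tau> ^ j)"] by (simp add: u_def algebra_simps)
  qed
  show "v = smult (Re \<tau>) (pderiv v) + smult (Im \<tau>) (pderiv u)"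
  proof -
    have "smult (Re \<tau>) (pderiv v) + smult (Im \<tau>) (pderiv u) =
        (\<Sum>j\<le>n. smult (Im (\<tau> ^ Suc j)) (D (Suc j)))"
      by (simp add: pu pv smult_sum_right smult_add_left sum.distrib)
    then show ?thesis
      using shift[of "\<lambda>j. Im (\<tau> ^ j)"] by (simp add: v_def)
  qed
  have "degree (D j) \<le> n" for j
    using assms by (simp add: D_def degree_higher_pderiv)
  then show "degree u \<le> n" "degree v \<le> n"
    by (auto simp: u_def v_def intro!: degree_sum_le order.trans[OF degree_smult_le])
  have "poly (D j) 0 = fact j * coeff p j" for j
    by (simp add: poly_0_coeff_0 D_def coeff_higher_pderiv pochhammer_fact)
  then show "Complex (poly u 0) (poly v 0) = (\<Sum>j\<le>n. \<tau> ^ j * of_real (fact j * coeff p j))"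
    by (simp add: complex_eq_iff u_def v_def poly_sum)
qed

text \<open>At a zero \<tau> the resolvent vanishes at t = 0, so both parts are divisible by t.
  Differentiation lowers the degree, hence the real part inherits the leading coefficient of
  \<open>p\<close> and the imaginary part has none in degree n.\<close>

lemma jacobi_resolvent:
  assumes "n > 0" and root: "(\<Sum>j\<le>n. \<tau> ^ j * of_real (jacobi_coeff \<alpha> \<beta> n j)) = (0 :: complex)"
  defines "p \<equiv> jacobi_poly \<alpha> \<beta> n"
  obtains v w where
    "pCons 0 v = p + smult (Re \<tau>) (pderiv (pCons 0 v)) - smult (Im \<tau>) (pderiv (pCons 0 w))"
    "pCons 0 w = smult (Re \<tau>) (pderiv (pCons 0 w)) + smult (Im \<tau>) (pderiv (pCons 0 v))"
    "degree (pCons 0 v) \<le> n" "coeff (pCons 0 v) n = coeff p n"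
    "coeff (pCons 0 v) (n - 1) = coeff p (n - 1) + Re \<tau> * real n * coeff p n"
    "degree (pCons 0 w) < n"
proof -
  have dp: "degree p \<le> n" by (simp add: p_def degree_jacobi_poly_le)
  obtain u u' where u: "u = p + smult (Re \<tau>) (pderiv u) - smult (Im \<tau>) (pderiv u')"
    and u': "u' = smult (Re \<tau>) (pderiv u') + smult (Im \<tau>) (pderiv u)"
    and deg: "degree u \<le> n" "degree u' \<le> n"
    and val: "Complex (poly u 0) (poly u' 0) = (\<Sum>j\<le>n. \<tau> ^ j * of_real (fact j * coeff p j))"
    by (rule resolvent_pair[OF dp])
  have "(\<Sum>j\<le>n. \<tau> ^ j * of_real (fact j * coeff p j)) = 0"
    using root by (simp add: p_def coeff_jacobi_poly)
  with val have 0: "poly u 0 = 0" "poly u' 0 = 0" by (simp_all add: complex_eq_iff)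
  obtain v w where vw: "u = pCons 0 v" "u' = pCons 0 w"
    using 0 by (metis pCons_cases poly_pCons mult_zero_left add.right_neutral)
  have cu: "coeff u k = coeff p k + Re \<tau> * (real (Suc k) * coeff u (Suc k)) - Im \<tau> * (real (Suc k) * coeff u' (Suc k))" for k
    using arg_cong[OF u, of "\<lambda>q. coeff q k"] by (simp add: coeff_pderiv)
  have cu': "coeff u' k = Re \<tau> * (real (Suc k) * coeff u' (Suc k)) + Im \<tau> * (real (Suc k) * coeff u (Suc k))" for k
    using arg_cong[OF u', of "\<lambda>q. coeff q k"] by (simp add: coeff_pderiv)
  have top: "coeff u (Suc n) = 0" "coeff u' (Suc n) = 0"
    using deg by (auto simp: coeff_eq_0)
  have un: "coeff u n = coeff p n" "coeff u' n = 0"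
    using cu[of n] cu'[of n] top by auto
  have "coeff u (n - 1) = coeff p (n - 1) + Re \<tau> * real n * coeff p n"
    using cu[of "n - 1"] un \<open>n > 0\<close> by simp
  moreover have "degree u' < n"
    using deg un \<open>n > 0\<close> by (metis coeff_0_degree_minus_1 degree_0 diff_less le_neq_implies_less less_one
        leading_coeff_0_iff)
  ultimately show ?thesis
    using that[of v w] u u' deg un vw by simp
qed

text \<open>
  For a zero \<open>\<tau>\<close> the solution of \<open>u - \<tau> u' = p\<close> is \<open>t (v + i w)\<close>; the equation is multiplied by
  \<open>(1 - t) (v - i w)\<close>, so that only the leading coefficient of the product meets \<open>p\<close>.
\<close>

lemma jacobi_stable_small_alpha:
  assumes "-1 < \<alpha>" "\<alpha> < 1" "-1 < \<beta>" "n > 0" "Re \<tau> \<le> 0"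
  shows "(\<Sum>j\<le>n. \<tau> ^ j * of_real (jacobi_coeff \<alpha> \<beta> n j)) \<noteq> (0 :: complex)"
proof
  assume root: "(\<Sum>j\<le>n. \<tau> ^ j * of_real (jacobi_coeff \<alpha> \<beta> n j)) = (0 :: complex)"
  define x where "x = Re \<tau>"
  define y where "y = Im \<tau>"
  define p where "p = jacobi_poly \<alpha> \<beta> n"
  define Y where "Y = [:1, -1 :: real:]"
  define L where "L = beta_moment (\<alpha> + 1) (\<beta> + 1)"
  obtain v w where
    ev: "pCons 0 v = p + smult x (pderiv (pCons 0 v)) - smult y (pderiv (pCons 0 w))" and
    ew: "pCons 0 w = smult x (pderiv (pCons 0 w)) + smult y (pderiv (pCons 0 v))" and
    deg: "degree (pCons 0 v) \<le> n" "coeff (pCons 0 v) n = coeff p n"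
    and "coeff (pCons 0 v) (n - 1) = coeff p (n - 1) + x * real n * coeff p n"
    and degw: "degree (pCons 0 w) < n"
    by (rule jacobi_resolvent[OF \<open>n > 0\<close> root, folded x_def y_def p_def])
  have cn: "(- 1) ^ n * coeff p n > 0"
    using jacobi_coeff_pos[of \<alpha> n \<beta> n] assms by (simp add: p_def coeff_jacobi_poly)
  have "v \<noteq> 0"
    using cn deg(2) by auto
  define g where "g = v * v + w * w"
  have g: "poly g t \<ge> 0" for t by (simp add: g_def)
  have "g \<noteq> 0"
  proof
    assume "g = 0"
    then have "poly v t * poly v t + poly w t * poly w t = 0" for t
      by (metis g_def poly_0 poly_add poly_mult)
    then have "poly v t = 0" for t by (simp add: sum_squares_eq_zero_iff)
    then show False using \<open>v \<noteq> 0\<close> by (simp add: poly_eq_poly_eq_iff[symmetric] fun_eq_iff)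
  qed
  \<comment> \<open>\<open>R\<close> and \<open>S\<close> are the real and imaginary parts of (t V)'
    times the conjugate of V.\<close>
  define R where "R = pderiv (pCons 0 v) * v + pderiv (pCons 0 w) * w"
  define S where "S = pderiv (pCons 0 w) * v - pderiv (pCons 0 v) * w"
  define X1 where "X1 = L (Y * R)"
  define X2 where "X2 = L (Y * S)"
  have degv: "degree v \<le> n - 1" "degree w < n - 1 \<or> w = 0"
    using deg degw \<open>v \<noteq> 0\<close> by (auto simp: degree_pCons_eq_if split: if_splits)
  have R: "R = g + pCons 0 (smult (1/2) (pderiv g))"
  proof -
    have "pderiv g = smult 2 (v * pderiv v + w * pderiv w)"
      by (simp add: g_def pderiv_add pderiv_mult algebra_simps flip: mult_2) (simp flip: smult_add_right add: mult_2 numeral_poly)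
    then show ?thesis by (simp add: R_def g_def pderiv_pCons algebra_simps)
  qed
  \<comment> \<open>Integration by parts leaves the coefficients 1 - \<alpha> and \<beta> + 1; their
    positivity is what restricts the parameters here.\<close>
  have X1_eq: "2 * X1 = (1 - \<alpha>) * beta_moment (\<alpha> + 1) (\<beta> + 2) g + (\<beta> + 1) * beta_moment (\<alpha> + 2) (\<beta> + 1) g"
  proof -
    have "X1 = beta_moment (\<alpha> + 1) (\<beta> + 1 + 1) R"
      unfolding X1_def L_def Y_def using assms by (intro beta_moment_one_minus_X) auto
    also have "\<dots> = beta_moment (\<alpha> + 1) (\<beta> + 2) g + 1/2 * beta_moment (\<alpha> + 2) (\<beta> + 2) (pderiv g)"
      by (simp only: R beta_moment_add beta_moment_X beta_moment_smult) (simp add: add_ac)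
    finally show ?thesis
      using beta_moment_pderiv[of "\<alpha> + 1" "\<beta> + 1" g] assms by (simp add: algebra_simps)
  qed
  have "X1 > 0"
  proof -
    have "beta_moment (\<alpha> + 1) (\<beta> + 2) g > 0" "beta_moment (\<alpha> + 2) (\<beta> + 1) g > 0"
      using assms g \<open>g \<noteq> 0\<close> by (auto intro!: beta_moment_pos)
    then have "(1 - \<alpha>) * beta_moment (\<alpha> + 1) (\<beta> + 2) g > 0"
      "(\<beta> + 1) * beta_moment (\<alpha> + 2) (\<beta> + 1) g > 0"
      using assms by simp_all
    with X1_eq show ?thesis by linarith
  qed
  \<comment> \<open>The moment of p (1-t) v is \<open>- H\<close>: the test polynomial has degree n
    and leading coefficient minus that of \<open>p\<close>.\<close>
  define H where "H = (- 1) ^ n * coeff p n * beta_moment (\<alpha> + 1) (\<beta> + real n + 1) p"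
  have "H > 0"
  proof -
    have "beta_moment (\<alpha> + 1) (\<beta> + real n + 1) p > 0"
      unfolding p_def using assms
      by (subst beta_moment_jacobi_poly) (auto simp: pochhammer_fact[symmetric] Beta_real_pos pochhammer_pos)
    then show ?thesis using cn by (simp add: H_def)
  qed
  have pv: "L (p * (Y * v)) = - H"
  proof -
    have "degree (Y * v) \<le> n"
      using degree_mult_le[of Y v] degv \<open>n > 0\<close> by (simp add: Y_def)
    moreover have "coeff (Y * v) n = - coeff p n"
      using deg(2) \<open>n > 0\<close> degv by (cases n) (auto simp: Y_def coeff_eq_0)
    ultimately show ?thesis
      using beta_moment_jacobi_poly_top[of \<alpha> \<beta> 0 "Y * v" n n] assms by (simp add: L_def p_def H_def)
  qed
  have pw: "L (p * (Y * w)) = 0"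
  proof (cases "w = 0")
    case False
    then have "degree (Y * w) < n"
      using degree_mult_le[of Y w] degv by (simp add: Y_def)
    then show ?thesis
      using jacobi_poly_orthogonal_degree[of \<alpha> \<beta> 0 "Y * w" n] assms by (simp add: L_def p_def)
  qed (simp add: L_def)
  define K where "K = L (Y * pCons 0 g)"
  have "poly (Y * pCons 0 g) t \<ge> 0" if "t \<in> {0..1}" for t
  proof -
    have "poly (Y * pCons 0 g) t = (1 - t) * (t * poly g t)"
      by (simp add: Y_def algebra_simps)
    also have "\<dots> \<ge> 0" using that g by (intro mult_nonneg_nonneg) auto
    finally show ?thesis .
  qed
  then have "K \<ge> 0"
    unfolding K_def L_def by (intro beta_moment_nonneg) (use assms in simp_all)
  \<comment> \<open>Real part of the tested equation.\<close>
  have "Y * pCons 0 g = Y * (pCons 0 v * v + pCons 0 w * w)"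
    by (simp add: g_def)
  also have "pCons 0 v * v + pCons 0 w * w = p * v + smult x R - smult y S"
    by (subst ev, subst ew) (simp add: R_def S_def algebra_simps smult_add_right smult_diff_right)
  also have "Y * \<dots> = p * (Y * v) + smult x (Y * R) - smult y (Y * S)"
    by (simp add: algebra_simps)
  finally have 1: "K = - H + x * X1 - y * X2"
    by (simp only: K_def X1_def X2_def pv[symmetric] L_def beta_moment_add beta_moment_diff beta_moment_smult)
  \<comment> \<open>Imaginary part: t V times the conjugate of V is real, so the left side is
    zero.\<close>
  have "0 = Y * (pCons 0 w * v - pCons 0 v * w)"
    by (simp add: mult.commute)
  also have "pCons 0 w * v - pCons 0 v * w = smult x S + smult y R - p * w"
    by (subst ev, subst ew) (simp add: R_def S_def algebra_simps smult_add_right smult_diff_right)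
  also have "Y * \<dots> = smult x (Y * S) + smult y (Y * R) - p * (Y * w)"
    by (simp add: algebra_simps)
  finally have "L 0 = L (smult x (Y * S) + smult y (Y * R) - p * (Y * w))"
    by (rule arg_cong)
  then have "L 0 = x * X2 + y * X1 - L (p * (Y * w))"
    by (simp only: X1_def X2_def L_def beta_moment_add beta_moment_diff beta_moment_smult)
  then have 2: "x * X2 = - y * X1"
    using pw by (simp add: L_def)
  \<comment> \<open>Eliminating \<open>X2\<close> gives x (K + H) = |\<tau>|^2 X1. The left side is
    at most 0 and \<open>X1 > 0\<close>, so \<tau> = 0, and then K = -H contradicts the
    signs.\<close>
  have "x * (K + H) = x * (x * X1) - y * (x * X2)"
    by (simp add: 1 algebra_simps)
  also have "\<dots> = (x\<^sup>2 + y\<^sup>2) * X1"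
    by (simp only: 2) (simp add: algebra_simps power2_eq_square)
  finally have e: "x * (K + H) = (x\<^sup>2 + y\<^sup>2) * X1" .
  have "x * (K + H) \<le> 0"
    using assms \<open>K \<ge> 0\<close> \<open>H > 0\<close> by (intro mult_nonpos_nonneg) (auto simp: x_def)
  with e \<open>X1 > 0\<close> have "x\<^sup>2 + y\<^sup>2 \<le> 0"
    by (metis mult_le_0_iff linorder_not_le not_less_iff_gr_or_eq)
  then have "x = 0" "y = 0" by (simp_all add: sum_power2_le_zero_iff)
  with 1 \<open>K \<ge> 0\<close> \<open>H > 0\<close> show False by simp
qed

text \<open>With one surplus power of 1 - t in the weight, two coefficients of \<open>q\<close>
  survive. Subtracting a multiple of (1-t)^n leaves degree n - 1, where
  \<open>beta_moment_jacobi_poly_top\<close> applies with d = 1; the power itself is evaluated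
  through \<open>pochhammer 2 n\<close>.\<close>

lemma beta_moment_jacobi_poly_top_two:
  fixes q :: "real poly"
  assumes "-1 < \<alpha>" "-2 < \<beta>" "n \<ge> 2" "degree q \<le> n"
  defines "p \<equiv> jacobi_poly \<alpha> \<beta> n"
  shows "beta_moment (\<alpha> + 1) (\<beta> + 2) (p * q) =
     (- 1) ^ n * beta_moment (\<alpha> + 1) (\<beta> + real n + 1) p *
     (coeff q n * ((real n + 1) * (real n + \<beta> + 1) / (2 * real n + \<alpha> + \<beta> + 2)) -
      (coeff q (n - 1) + real n * coeff q n))"
proof -
  define c where "c = (- 1) ^ n * coeff q n"
  define r where "r = q - smult c ([:1, -1:] ^ n)"
  define M where "M = beta_moment (\<alpha> + 1) (\<beta> + real n + 1) p"
  obtain m where m: "n = Suc m" using \<open>n \<ge> 2\<close> by (cases n) auto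
  have cr: "coeff r m = coeff q m + real n * coeff q n"
  proof -
    have "coeff ([:1, -1 :: real:] ^ n) m = real n * (- 1) ^ m"
      by (subst coeff_linear_poly_power) (auto simp: m)
    then show ?thesis
      by (simp add: r_def c_def m power_mult_distrib[symmetric] flip: power_Suc) (simp add: m)
  qed
  have "degree r \<le> m"
    using degree_minus_top_one_minus_X_power[of q m] assms by (simp add: r_def c_def m)
  then have pr: "beta_moment (\<alpha> + 1) (\<beta> + 2) (p * r) = (- 1) ^ m * coeff r m * M"
    using beta_moment_jacobi_poly_top[of \<alpha> \<beta> 1 r m n] assms(1,2) m by (simp add: M_def p_def add.assoc)
  have "beta_moment (\<alpha> + 1) (\<beta> + 2) ([:1, -1:] ^ n * p) = beta_moment (\<alpha> + 1) (\<beta> + 2 + real n) p"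
    using assms by (intro beta_moment_one_minus_X_power) auto
  also have "\<dots> = (real n + 1) * (real n + \<beta> + 1) / (2 * real n + \<alpha> + \<beta> + 2) * M"
  proof -
    define z where "z = \<alpha> + \<beta> + real n + 2"
    define b where "b = \<beta> + real n + 1"
    have z: "z > 0" "z + real n > 0" and b: "b > 0" using assms by (auto simp: z_def b_def)
    have zb: "z = \<alpha> + 1 + b" by (simp add: z_def b_def)
    have pz: "pochhammer (z + 1) n = pochhammer z n * (z + real n) / z"
      using pochhammer_rec[of z n] pochhammer_Suc[of z n] z by (simp add: eq_divide_eq mult.commute)
    have "(\<alpha> + 1 + b) * Beta (\<alpha> + 1) (b + 1) = b * Beta (\<alpha> + 1) b"
      using b by (intro Beta_plus1_right pos_notin_nonpos_Ints) auto
    then have B: "Beta (\<alpha> + 1) (b + 1) = b * Beta (\<alpha> + 1) b / z"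
      using z by (simp add: zb field_simps)
    have "beta_moment (\<alpha> + 1) (\<beta> + 2 + real n) p = Beta (\<alpha> + 1) (b + 1) * pochhammer 2 n / pochhammer (z + 1) n"
      unfolding p_def using assms by (subst beta_moment_jacobi_poly) (auto simp: z_def b_def add_ac)
    also have "\<dots> = (real n + 1) * b / (z + real n) * (Beta (\<alpha> + 1) b * fact n / pochhammer z n)"
      using z by (simp add: B pz pochhammer_two mult_ac)
    also have "Beta (\<alpha> + 1) b * fact n / pochhammer z n = M"
      unfolding p_def M_def using assms
      by (subst beta_moment_jacobi_poly) (auto simp: z_def b_def add_ac pochhammer_fact)
    also have "z + real n = 2 * real n + \<alpha> + \<beta> + 2" by (simp add: z_def)
    also have "b = real n + \<beta> + 1" by (simp add: b_def)
    finally show ?thesis .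
  qed
  finally have pY: "beta_moment (\<alpha> + 1) (\<beta> + 2) ([:1, -1:] ^ n * p) =
    (real n + 1) * (real n + \<beta> + 1) / (2 * real n + \<alpha> + \<beta> + 2) * M" .
  have "p * q = p * r + smult c ([:1, -1:] ^ n * p)"
    by (simp add: r_def algebra_simps)
  then have "beta_moment (\<alpha> + 1) (\<beta> + 2) (p * q) = (- 1) ^ m * coeff r m * M +
     c * ((real n + 1) * (real n + \<beta> + 1) / (2 * real n + \<alpha> + \<beta> + 2) * M)"
    by (simp only: beta_moment_add beta_moment_smult pr pY)
  then show ?thesis
    unfolding cr c_def M_def[symmetric] by (simp add: m algebra_simps)
qed

lemma jacobi_coeff_Suc:
  "jacobi_coeff \<alpha> \<beta> n (Suc k) = jacobi_coeff \<alpha> \<beta> n k *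
     ((real k - real n) * (real n + \<alpha> + \<beta> + 1 + real k)) / (\<alpha> + 1 + real k)"
  by (simp add: jacobi_coeff_def pochhammer_Suc mult_ac)

text \<open>After clearing denominators and substituting q = n + \<beta> + 1 > 0 and e = \<alpha> +
  1 > 0, the difference is a sum of nonnegative terms with a positive one. The term q (n - 3)
  accounts for the bound on n.\<close>

lemma quotient_gap:
  fixes n :: nat and \<alpha> \<beta> :: real
  assumes "-1 < \<alpha>" "-2 < \<beta>" "n \<ge> 3"
  shows "(real n - 1) * (real n + \<beta>) / (2 * real n + \<alpha> + \<beta>) <
         (real n + 1) * (real n + \<beta> + 1) / (2 * real n + \<alpha> + \<beta> + 2)"
proof -
  define m where "m = real n"
  define q where "q = real n + \<beta> + 1"
  define e where "e = \<alpha> + 1"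
  have m: "m \<ge> 3" and q: "q > 0" "e > 0" using assms by (auto simp: m_def q_def e_def)
  have "(m + 1) * q * (m + q + e - 2) - (m - 1) * (q - 1) * (m + q + e) =
     2 * q\<^sup>2 + q * (m - 3) + m * (m - 1) + e * (2 * q + m - 1)"
    by (simp add: algebra_simps power2_eq_square)
  also have "\<dots> > 0"
    using m q by (intro add_pos_nonneg add_nonneg_pos mult_nonneg_nonneg mult_pos_pos) auto
  finally have "(m - 1) * (q - 1) * (m + q + e) < (m + 1) * q * (m + q + e - 2)" by simp
  moreover have "2 * m + \<alpha> + \<beta> = m + q + e - 2" "2 * m + \<alpha> + \<beta> + 2 = m + q + e" "m + \<beta> = q - 1" "m + \<beta> + 1 = q"
    by (auto simp: m_def q_def e_def)
  moreover have "m + q + e - 2 > 0" "m + q + e > 0" using assms m q by (auto simp: m_def q_def e_def)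
  ultimately show ?thesis
    unfolding m_def[symmetric] by (simp only:) (simp add: divide_simps mult_ac)
qed

text \<open>
  Here \<open>\<beta>\<close> may be below \<open>-1\<close>, so the weight uses \<open>\<beta> + 1\<close> instead, for which the Jacobi polynomial
  is orthogonal only to degrees below \<open>n - 1\<close>. With \<open>(1 - t) u'\<close> as test function the two remaining
  coefficients contribute with the right sign.
\<close>

lemma jacobi_stable_nonpos_alpha:
  assumes "-1 < \<alpha>" "\<alpha> \<le> 0" "-2 < \<beta>" "n \<ge> 3" "Re \<tau> \<le> 0"
  shows "(\<Sum>j\<le>n. \<tau> ^ j * of_real (jacobi_coeff \<alpha> \<beta> n j)) \<noteq> (0 :: complex)"
proof
  assume root: "(\<Sum>j\<le>n. \<tau> ^ j * of_real (jacobi_coeff \<alpha> \<beta> n j)) = (0 :: complex)"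
  define x where "x = Re \<tau>"
  define y where "y = Im \<tau>"
  define p where "p = jacobi_poly \<alpha> \<beta> n"
  define Y where "Y = [:1, -1 :: real:]"
  have "n > 0" using assms by simp
  obtain v w where
    ev: "pCons 0 v = p + smult x (pderiv (pCons 0 v)) - smult y (pderiv (pCons 0 w))" and
    ew: "pCons 0 w = smult x (pderiv (pCons 0 w)) + smult y (pderiv (pCons 0 v))" and
    deg: "degree (pCons 0 v) \<le> n" "coeff (pCons 0 v) n = coeff p n" and
    second: "coeff (pCons 0 v) (n - 1) = coeff p (n - 1) + x * real n * coeff p n"
    and "degree (pCons 0 w) < n"
    by (rule jacobi_resolvent[OF \<open>n > 0\<close> root, folded x_def y_def p_def])
  \<comment> \<open>Here \<open>u'\<close> is the imaginary part of the solution U = u + i u', not a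
    derivative.\<close>
  define u where "u = pCons 0 v"
  define u' where "u' = pCons 0 w"
  define L where "L = beta_moment (\<alpha> + 1) (\<beta> + 3)"
  define C where "C = (- 1) ^ n * coeff p n"
  have "C > 0"
    using jacobi_coeff_pos[of \<alpha> n \<beta> n] assms by (simp add: C_def p_def coeff_jacobi_poly)
  define d where "d = 2 * real n + \<alpha> + \<beta>"
  have "d > 0" using assms by (simp add: d_def)
  obtain m where m: "n = Suc (Suc m)"
    using assms(4) that[of "n - 2"] by simp
  \<comment> \<open>Ratio of the two leading coefficients of \<open>p\<close>, both of which enter
    below.\<close>
  have "coeff p n * (\<alpha> + real n) * real n = - (coeff p (n - 1) * d)"
  proof -
    define J where "J = jacobi_coeff \<alpha> \<beta> n (n - 1)"
    have "\<alpha> + real n > 0" using assms by simp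
    have "jacobi_coeff \<alpha> \<beta> n n = - (J * d) / (\<alpha> + real n)"
      using jacobi_coeff_Suc[of \<alpha> \<beta> n "n - 1"] \<open>n > 0\<close>
      by (simp add: J_def d_def algebra_simps)
    then have "jacobi_coeff \<alpha> \<beta> n n * (\<alpha> + real n) = - (J * d)"
      using \<open>\<alpha> + real n > 0\<close> by (simp add: eq_divide_eq)
    moreover have "coeff p n * real n = jacobi_coeff \<alpha> \<beta> n n / fact (n - 1)"
      using \<open>n > 0\<close> by (simp add: p_def coeff_jacobi_poly fact_reduce)
    moreover have "coeff p (n - 1) = J / fact (n - 1)"
      by (simp add: p_def coeff_jacobi_poly J_def)
    ultimately show ?thesis
      by (simp add: mult.assoc mult.left_commute[of _ "\<alpha> + real n"] mult.commute[of _ "\<alpha> + real n"])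
  qed
  then have cn1: "coeff p (n - 1) = - real n * (\<alpha> + real n) / d * coeff p n"
    using \<open>d > 0\<close> by (simp add: field_simps)
  define M where "M = beta_moment (\<alpha> + 1) (\<beta> + real n + 1) p"
  have "M > 0"
    unfolding M_def p_def using assms
    by (subst beta_moment_jacobi_poly) (auto simp: pochhammer_fact[symmetric] Beta_real_pos pochhammer_pos)
  define g where "g = v * v + w * w"
  have G: "poly (pCons 0 g) t \<ge> 0" if "t \<in> {0..1}" for t
    using that by (simp add: g_def)
  \<comment> \<open>The integrand is half the derivative of |U|^2 = t^2 g. Integration by parts
    gives the coefficients -\<alpha> and \<beta> + 2, both nonnegative in the present range.\<close>
  have "2 * L (u * pderiv u + u' * pderiv u') =
    - \<alpha> * beta_moment (\<alpha> + 1) (\<beta> + 3) (pCons 0 g) + (\<beta> + 2) * beta_moment (\<alpha> + 2) (\<beta> + 2) (pCons 0 g)"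
  proof -
    have "pderiv (pCons 0 (pCons 0 g)) = smult 2 (u * pderiv u + u' * pderiv u')"
    proof -
      have "pCons 0 (pCons 0 g) = u * u + u' * u'" by (simp add: u_def u'_def g_def)
      moreover have "smult 2 f = 2 * f" for f :: "real poly" by (simp add: numeral_poly)
      ultimately show ?thesis by (simp add: pderiv_add pderiv_mult algebra_simps)
    qed
    then have "2 * L (u * pderiv u + u' * pderiv u') = L (pderiv (pCons 0 (pCons 0 g)))"
      by (simp add: L_def beta_moment_smult)
    also have "\<dots> = L (pCons 0 g) + beta_moment (\<alpha> + 2) (\<beta> + 3) (pderiv (pCons 0 g))"
      unfolding L_def pderiv_pCons[of 0 "pCons 0 g"] beta_moment_add beta_moment_X by (simp add: add_ac)
    finally show ?thesis
      using beta_moment_pderiv[of "\<alpha> + 1" "\<beta> + 2" "pCons 0 g"] assms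
      by (simp add: algebra_simps L_def)
  qed
  moreover
  have "- \<alpha> * beta_moment (\<alpha> + 1) (\<beta> + 3) (pCons 0 g) \<ge> 0"
    "(\<beta> + 2) * beta_moment (\<alpha> + 2) (\<beta> + 2) (pCons 0 g) \<ge> 0"
    by (intro mult_nonneg_nonneg beta_moment_nonneg G; use assms in simp)+
  ultimately have lhs: "L (u * pderiv u + u' * pderiv u') \<ge> 0" by simp
  \<comment> \<open>Pairing with the conjugate of U' cancels the terms with Im \<tau>.\<close>
  have "u * pderiv u + u' * pderiv u' = (p + smult x (pderiv u) - smult y (pderiv u')) * pderiv u +
      (smult x (pderiv u') + smult y (pderiv u)) * pderiv u'"
    by (rule arg_cong2[OF ev[folded u_def u'_def] ew[folded u_def u'_def],
          of "\<lambda>a b. a * pderiv u + b * pderiv u'"])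
  also have "\<dots> = p * pderiv u + smult x (pderiv u * pderiv u + pderiv u' * pderiv u')"
    by (simp add: algebra_simps smult_add_right)
  finally have eq: "L (u * pderiv u + u' * pderiv u') =
      L (p * pderiv u) + x * L (pderiv u * pderiv u + pderiv u' * pderiv u')"
    by (simp add: L_def beta_moment_add beta_moment_smult)
  have "L (pderiv u * pderiv u + pderiv u' * pderiv u') \<ge> 0"
    unfolding L_def using assms by (intro beta_moment_nonneg) auto
  then have xL: "x * L (pderiv u * pderiv u + pderiv u' * pderiv u') \<le> 0"
    using assms by (intro mult_nonpos_nonneg) (auto simp: x_def)
  \<comment> \<open>Moving one factor 1 - t from the weight into the test polynomial makes the
    two-coefficient formula applicable.\<close>
  define q where "q = Y * pderiv u"
  have "degree u \<le> n" using deg by (simp add: u_def)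
  then have "degree q \<le> n"
    using degree_mult_le[of Y "pderiv u"] \<open>n > 0\<close> by (simp add: q_def Y_def degree_pderiv)
  have qn: "coeff q n = - real n * coeff p n"
  proof -
    have "coeff q n = coeff (pderiv u) n - coeff (pderiv u) (n - 1)"
      by (simp add: q_def Y_def m)
    also have "coeff (pderiv u) n = 0"
      using \<open>degree u \<le> n\<close> by (simp add: coeff_pderiv coeff_eq_0)
    also have "coeff (pderiv u) (n - 1) = real n * coeff p n"
      using deg(2) \<open>n > 0\<close> by (simp add: coeff_pderiv u_def)
    finally show ?thesis by simp
  qed
  have qn1: "coeff q (n - 1) = real n * coeff p n - (real n - 1) * (coeff p (n - 1) + x * real n * coeff p n)"
  proof -
    have "coeff q (n - 1) = coeff (pderiv u) (n - 1) - coeff (pderiv u) (n - 2)"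
      by (simp add: q_def Y_def m)
    also have "\<dots> = real n * coeff u n - (real n - 1) * coeff u (n - 1)"
      by (simp add: coeff_pderiv m)
    finally show ?thesis
      using deg(2) second by (simp add: u_def)
  qed
  have "L (p * pderiv u) = beta_moment (\<alpha> + 1) (\<beta> + 2) (p * q)"
    using beta_moment_one_minus_X[of "\<alpha> + 1" "\<beta> + 2" "p * pderiv u"] assms
    by (simp add: L_def q_def Y_def mult.left_commute[of p] add_ac del: mult_pCons_left mult_pCons_right)
  also have "\<dots> = (- 1) ^ n * M *
     (coeff q n * ((real n + 1) * (real n + \<beta> + 1) / (d + 2)) -
      (coeff q (n - 1) + real n * coeff q n))"
    using beta_moment_jacobi_poly_top_two[of \<alpha> \<beta> n q] assms \<open>degree q \<le> n\<close>
    by (simp add: M_def p_def d_def)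
  also have "\<dots> = real n * C * M * ((real n - 1) * (1 - (\<alpha> + real n) / d)
      - (real n + 1) * (real n + \<beta> + 1) / (d + 2) + (real n - 1) * x)"
  proof -
    define A B where "A = (\<alpha> + real n) / d"
      and "B = (real n + 1) * (real n + \<beta> + 1) / (d + 2)"
    have cA: "coeff p (n - 1) = - real n * A * coeff p n" using cn1 by (simp only: A_def times_divide_eq_right)
    show ?thesis
      unfolding qn qn1 cA C_def A_def[symmetric] B_def[symmetric] by (simp add: algebra_simps)
  qed
  also have "(real n - 1) * (1 - (\<alpha> + real n) / d) = (real n - 1) * (real n + \<beta>) / d"
    using \<open>d > 0\<close> by (simp add: divide_simps) (simp add: d_def algebra_simps)
  also have "real n * C * M * ((real n - 1) * (real n + \<beta>) / d
      - (real n + 1) * (real n + \<beta> + 1) / (d + 2) + (real n - 1) * x) < 0"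
  \<comment> \<open>\<open>quotient_gap\<close> makes the bracket negative, and Re \<tau> \<le> 0
    only lowers it; this contradicts \<open>lhs\<close> and \<open>xL\<close>.\<close>
  proof -
    have "(real n - 1) * x \<le> 0"
      using assms by (intro mult_nonneg_nonpos) (auto simp: x_def)
    then have "(real n - 1) * (real n + \<beta>) / d
      - (real n + 1) * (real n + \<beta> + 1) / (d + 2) + (real n - 1) * x < 0"
      using quotient_gap[of \<alpha> \<beta> n] assms unfolding d_def by linarith
    then show ?thesis
      using \<open>n > 0\<close> \<open>C > 0\<close> \<open>M > 0\<close> by (intro mult_pos_neg mult_pos_pos) auto
  qed
  finally show False
    using lhs eq xL by linarith
qed


section \<open>The Hermite-Biehler theorem\<close>

abbreviation cpoly :: "real poly \<Rightarrow> complex poly" where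
  "cpoly \<equiv> map_poly complex_of_real"

section \<open>Passage from real to complex polynomials\<close>

lemma cpoly_add: "cpoly (p + q) = cpoly p + cpoly q"
  by (rule poly_eqI) (simp add: coeff_map_poly)

lemma cpoly_smult: "cpoly (smult c p) = smult (of_real c) (cpoly p)"
  by (rule poly_eqI) (simp add: coeff_map_poly)

lemma cpoly_mult: "cpoly (p * q) = cpoly p * cpoly q"
  by (rule poly_eqI) (simp add: coeff_map_poly coeff_mult)

lemma cpoly_pderiv: "pderiv (cpoly p) = cpoly (pderiv p)"
  by (rule poly_eqI) (simp add: coeff_map_poly coeff_pderiv)

lemma degree_cpoly: "degree (cpoly p) = degree p"
  by (simp add: degree_map_poly)

lemma cpoly_pCons: "cpoly (pCons a p) = pCons (of_real a) (cpoly p)"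
  by (rule poly_eqI) (simp add: coeff_map_poly coeff_pCons split: nat.splits)

lemma poly_cpoly_of_real: "poly (cpoly p) (of_real x) = of_real (poly p x)"
  by (induction p) (simp_all add: cpoly_pCons)

lemma poly_cpoly_cnj: "poly (cpoly p) (cnj z) = cnj (poly (cpoly p) z)"
  by (induction p) (simp_all add: cpoly_pCons)

lemma poly_cpoly_pcompose: "poly (cpoly (pcompose p q)) z = poly (cpoly p) (poly (cpoly q) z)"
  by (induction p) (simp_all add: pcompose_pCons cpoly_pCons cpoly_add cpoly_mult)

section \<open>Linear factors and logarithmic derivatives\<close>

lemma pderiv_prod_linear:
  fixes r :: "nat \<Rightarrow> 'a :: field"
  assumes "\<And>i. i < n \<Longrightarrow> z \<noteq> r i"
  shows "poly (pderiv (\<Prod>i<n. [:- r i, 1:])) z = poly (\<Prod>i<n. [:- r i, 1:]) z * (\<Sum>i<n. 1 / (z - r i))"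
  using assms
proof (induction n)
  case (Suc n)
  let ?Q = "\<Prod>i<n. [:- r i, 1:]"
  have "z - r n \<noteq> 0" using Suc.prems[of n] by simp
  have "poly (pderiv (?Q * [:- r n, 1:])) z = poly ?Q z + (z - r n) * poly (pderiv ?Q) z"
    by (simp only: pderiv_mult poly_add poly_mult) (simp add: pderiv_pCons algebra_simps)
  also have "poly (pderiv ?Q) z = poly ?Q z * (\<Sum>i<n. 1 / (z - r i))"
    using Suc by simp
  also have "poly ?Q z + (z - r n) * (poly ?Q z * (\<Sum>i<n. 1 / (z - r i))) =
      (poly ?Q z * (z - r n)) * ((\<Sum>i<n. 1 / (z - r i)) + 1 / (z - r n))"
    using \<open>z - r n \<noteq> 0\<close> by (simp only: distrib_left) (simp add: mult_ac)
  finally show ?case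
    by (simp only: prod.lessThan_Suc sum.lessThan_Suc poly_mult) simp
qed (simp add: pderiv_1)

lemma logderiv_eq_sum:
  fixes p :: "complex poly"
  obtains r where "p = smult (lead_coeff p) (\<Prod>i<degree p. [:- r i, 1:])"
    "\<And>i. i < degree p \<Longrightarrow> poly p (r i) = 0"
    "\<And>z. poly p z \<noteq> 0 \<Longrightarrow> poly (pderiv p) z / poly p z = (\<Sum>i<degree p. 1 / (z - r i))"
proof -
  define n where "n = degree p"
  obtain r where r: "smult (lead_coeff p) (\<Prod>i<n. [:- r i, 1:]) = p"
    unfolding n_def by (rule complex_poly_decompose')
  have root: "poly p (r i) = 0" if "i < n" for i
  proof -
    have "poly p (r i) = lead_coeff p * (\<Prod>j<n. r i - r j)"
      by (subst r[symmetric]) (simp add: poly_prod)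
    then show ?thesis using that by (auto simp: prod_zero_iff)
  qed
  show ?thesis
  proof (rule that[of r])
    show "p = smult (lead_coeff p) (\<Prod>i<degree p. [:- r i, 1:])"
      using r by (simp add: n_def)
    show "poly p (r i) = 0" if "i < degree p" for i using root that by (simp add: n_def)
    fix z assume z: "poly p z \<noteq> 0"
    then have "poly (pderiv (\<Prod>i<n. [:- r i, 1:])) z =
        poly (\<Prod>i<n. [:- r i, 1:]) z * (\<Sum>i<n. 1 / (z - r i))"
      using root by (intro pderiv_prod_linear) auto
    moreover have "poly p z = lead_coeff p * poly (\<Prod>i<n. [:- r i, 1:]) z"
      "poly (pderiv p) z = lead_coeff p * poly (pderiv (\<Prod>i<n. [:- r i, 1:])) z"
      by (subst r[symmetric], simp add: pderiv_smult)+
    ultimately show "poly (pderiv p) z / poly p z = (\<Sum>i<degree p. 1 / (z - r i))"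
      using z by (simp add: n_def)
  qed
qed

text \<open>Every root lies in the left half-plane, hence closer to the mirror image
  \<open>- cnj s\<close> than to \<open>s\<close>; compare the linear factors.\<close>

lemma hurwitz_norm_less:
  fixes p :: "complex poly"
  assumes "degree p > 0" "\<And>z. poly p z = 0 \<Longrightarrow> Re z < 0" "Re s > 0"
  shows "norm (poly p (- cnj s)) < norm (poly p s)"
proof -
  obtain r where r: "p = smult (lead_coeff p) (\<Prod>i<degree p. [:- r i, 1:])"
    and root: "\<And>i. i < degree p \<Longrightarrow> poly p (r i) = 0"
    using logderiv_eq_sum[of p] by metis
  have eval: "norm (poly p z) = norm (lead_coeff p) * (\<Prod>i<degree p. norm (z - r i))" for z
    by (subst r) (simp add: poly_prod norm_mult prod_norm)
  have less: "norm (- cnj s - r i) < norm (s - r i)" if "i < degree p" for i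
  proof -
    have "Re (r i) < 0" using assms(2) root that by blast
    then have "0 < - 4 * (Re s * Re (r i))" using assms(3) by (simp add: mult_pos_neg)
    then have "(Re (- cnj s - r i))\<^sup>2 + (Im (- cnj s - r i))\<^sup>2 < (Re (s - r i))\<^sup>2 + (Im (s - r i))\<^sup>2"
      by (simp add: power2_eq_square algebra_simps)
    then show ?thesis by (simp add: cmod_def)
  qed
  then have "(\<Prod>i<degree p. norm (- cnj s - r i)) < (\<Prod>i<degree p. norm (s - r i))"
    using assms(1) less le_less_trans[OF norm_ge_zero less]
    by (intro prod_mono_strict[of 0]) (auto intro: less_imp_le simp del: zero_less_norm_iff)
  moreover have "lead_coeff p \<noteq> 0" using assms(1) by auto
  ultimately show ?thesis unfolding eval by simp
qed

text \<open>Each partial fraction 1/(s - r) has positive real part because Re (s - r) > 0.\<close>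

lemma hurwitz_logderiv_Re_pos:
  fixes p :: "complex poly"
  assumes "degree p > 0" "\<And>z. poly p z = 0 \<Longrightarrow> Re z < 0" "Re s \<ge> 0"
  shows "Re (poly (pderiv p) s / poly p s) > 0"
proof -
  obtain r where root: "\<And>i. i < degree p \<Longrightarrow> poly p (r i) = 0"
    and log: "\<And>z. poly p z \<noteq> 0 \<Longrightarrow> poly (pderiv p) z / poly p z = (\<Sum>i<degree p. 1 / (z - r i))"
    using logderiv_eq_sum[of p] by metis
  have "Re (1 / (s - r i)) > 0" if "i < degree p" for i
  proof -
    have "Re (s - r i) > 0" using assms(2)[OF root[OF that]] assms(3) by simp
    moreover from this have "s - r i \<noteq> 0" by (metis less_irrefl zero_complex.sel(1))
    ultimately show ?thesis by (simp add: Re_divide sum_power2_gt_zero_iff complex_eq_iff)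
  qed
  then have "(\<Sum>i<degree p. Re (1 / (s - r i))) > 0"
    using assms(1) by (intro sum_pos) auto
  moreover have "poly p s \<noteq> 0" using assms(2,3) by force
  ultimately show ?thesis by (simp add: log)
qed

text \<open>Simplicity is stated through the derivative. The zero polynomial fails the condition,
  nonzero constants satisfy it.\<close>

definition neg_simple_zeros :: "real poly \<Rightarrow> bool" where
  "neg_simple_zeros p \<longleftrightarrow> (\<forall>z. poly (cpoly p) z = 0 \<longrightarrow>
     Im z = 0 \<and> Re z < 0 \<and> poly (cpoly (pderiv p)) z \<noteq> 0)"

lemma neg_simple_zeros_smult: "c \<noteq> 0 \<Longrightarrow> neg_simple_zeros (smult c p) \<longleftrightarrow> neg_simple_zeros p"
  by (simp add: neg_simple_zeros_def pderiv_smult cpoly_smult)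

lemma Re_of_real_divide_imaginary:
  "Re s = 0 \<Longrightarrow> Re (of_real a / (s * of_real b)) = 0" "Re s = 0 \<Longrightarrow> Re (s * of_real b / of_real a) = 0"
  by (simp_all add: Re_divide)

text \<open>Put f(s) = e(s^2) + s d(s^2). If e or d vanishes at s^2, then |f(-s)| = |f(s)|, which
  forces s onto the imaginary axis and s^2 onto the negative reals. At a multiple zero f'/f would be
  purely imaginary there, against \<open>hurwitz_logderiv_Re_pos\<close>.\<close>

theorem hermite_biehler:
  fixes e d :: "real poly"
  assumes stable: "\<And>s. Re s \<ge> 0 \<Longrightarrow> poly (cpoly e) (s\<^sup>2) + s * poly (cpoly d) (s\<^sup>2) \<noteq> 0"
    and d0: "poly d 0 \<noteq> 0"
  shows "neg_simple_zeros e" "neg_simple_zeros d"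
proof -
  define X2 where "X2 = [:0, 0, 1 :: real:]"
  define f where "f = pcompose e X2 + pCons 0 (pcompose d X2)"
  have X2: "poly (cpoly X2) s = s\<^sup>2" "poly X2 x = x\<^sup>2" for s x
    by (simp_all add: X2_def cpoly_pCons power2_eq_square)
  have f: "poly (cpoly f) s = poly (cpoly e) (s\<^sup>2) + s * poly (cpoly d) (s\<^sup>2)" for s
    by (simp add: f_def cpoly_add cpoly_pCons poly_cpoly_pcompose X2)
  have dX2: "pderiv X2 = [:0, 2:]"
    by (simp add: X2_def pderiv_pCons)
  have df: "poly (pderiv (cpoly f)) s = 2 * s * poly (cpoly (pderiv e)) (s\<^sup>2) +
      poly (cpoly d) (s\<^sup>2) + 2 * s\<^sup>2 * poly (cpoly (pderiv d)) (s\<^sup>2)" for s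
    unfolding cpoly_pderiv f_def
    by (simp add: pderiv_add pderiv_pCons pderiv_pcompose dX2 cpoly_add cpoly_mult cpoly_pCons cpoly_smult
        poly_cpoly_pcompose X2 power2_eq_square)
  \<comment> \<open>f'(0) = d(0) is nonzero.\<close>
  have deg: "degree (cpoly f) > 0"
  proof (rule ccontr)
    assume "\<not> degree (cpoly f) > 0"
    then have "pderiv (cpoly f) = 0" by (simp add: pderiv_eq_0_iff)
    then have "poly (cpoly d) 0 = 0" using df[of 0] by simp
    with d0 show False using poly_cpoly_of_real[of d 0] by simp
  qed
  have neg: "Re z < 0" if "poly (cpoly f) z = 0" for z
    using that stable[of z] f[of z] by force
  have norm_less: "norm (poly (cpoly f) (- s)) < norm (poly (cpoly f) s)" if "Re s > 0" for s
  proof -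
    have "norm (poly (cpoly f) (- cnj s)) = norm (poly (cpoly f) (- s))"
      using poly_cpoly_cnj[of f "- s"] by simp
    with hurwitz_norm_less[OF deg neg that] show ?thesis by simp
  qed
  have log_pos: "Re (poly (pderiv (cpoly f)) s / poly (cpoly f) s) > 0" if "Re s = 0" for s
    using hurwitz_logderiv_Re_pos[OF deg neg] that by simp
  have real_arg: "\<exists>x. z = of_real x \<and> x < 0" if "s\<^sup>2 = z" "Re s = 0" "z \<noteq> 0" for s z
  proof -
    have "s\<^sup>2 = of_real (- (Im s)\<^sup>2)"
      using that by (simp add: complex_eq_iff power2_eq_square)
    moreover have "Im s \<noteq> 0" using that by (auto simp: complex_eq_iff)
    ultimately show ?thesis using that by (intro exI[of _ "- (Im s)\<^sup>2"]) auto
  qed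
  show "neg_simple_zeros e"
    unfolding neg_simple_zeros_def
  proof (intro allI impI)
    fix z assume z: "poly (cpoly e) z = 0"
    \<comment> \<open>The principal root has Re s \<ge> 0, so only Re s > 0 remains to be
      excluded.\<close>
    define s where "s = csqrt z"
    have s: "s\<^sup>2 = z" "Re s \<ge> 0" using csqrt_principal[of z] by (auto simp: s_def simp del: csqrt.simps)
    have "\<not> Re s > 0" using norm_less[of s] by (auto simp: f s z norm_mult)
    with s have s0: "Re s = 0" by simp
    have "z \<noteq> 0" using stable[of 0] z by auto
    then obtain x where x: "z = of_real x" "x < 0" using real_arg[OF s(1) s0] by blast
    have "poly (cpoly (pderiv e)) z \<noteq> 0"
    proof
      assume "poly (cpoly (pderiv e)) z = 0"
      then have "poly (pderiv (cpoly f)) s = of_real (poly d x + 2 * x * poly (pderiv d) x)"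
        "poly (cpoly f) s = s * of_real (poly d x)"
        using z by (simp_all add: f df s x poly_cpoly_of_real)
      then have "Re (poly (pderiv (cpoly f)) s / poly (cpoly f) s) = 0"
        by (simp only: Re_of_real_divide_imaginary(1)[OF s0])
      then show False using log_pos[OF s0] by simp
    qed
    then show "Im z = 0 \<and> Re z < 0 \<and> poly (cpoly (pderiv e)) z \<noteq> 0" using x by simp
  qed
  show "neg_simple_zeros d"
    unfolding neg_simple_zeros_def
  proof (intro allI impI)
    fix z assume z: "poly (cpoly d) z = 0"
    define s where "s = csqrt z"
    have s: "s\<^sup>2 = z" "Re s \<ge> 0" using csqrt_principal[of z] by (auto simp: s_def simp del: csqrt.simps)
    have "\<not> Re s > 0" using norm_less[of s] by (auto simp: f s z)
    with s have s0: "Re s = 0" by simp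
    have "z \<noteq> 0" using d0 z poly_cpoly_of_real[of d 0] by auto
    then obtain x where x: "z = of_real x" "x < 0" using real_arg[OF s(1) s0] by blast
    have "poly (cpoly (pderiv d)) z \<noteq> 0"
    proof
      assume "poly (cpoly (pderiv d)) z = 0"
      then have "poly (pderiv (cpoly f)) s = s * of_real (2 * poly (pderiv e) x)"
        "poly (cpoly f) s = of_real (poly e x)"
        using z by (simp_all add: f df s x poly_cpoly_of_real)
      then have "Re (poly (pderiv (cpoly f)) s / poly (cpoly f) s) = 0"
        by (simp only: Re_of_real_divide_imaginary(2)[OF s0])
      then show False using log_pos[OF s0] by simp
    qed
    then show "Im z = 0 \<and> Re z < 0 \<and> poly (cpoly (pderiv d)) z \<noteq> 0" using x by simp
  qed
qed


section \<open>Interlacing of combinations of a polynomial and its Euler derivative\<close>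

text \<open>The complex factorization has real roots, so comparing coefficients brings it down to
  the reals.\<close>

lemma neg_real_zeros_factorization:
  assumes "\<And>z. poly (cpoly h) z = 0 \<Longrightarrow> Im z = 0 \<and> Re z < 0"
  obtains r where "h = smult (lead_coeff h) (\<Prod>i<degree h. [:- r i, 1:])"
    "\<And>i. i < degree h \<Longrightarrow> r i < 0"
    "\<And>i. i < degree h \<Longrightarrow> poly h (r i) = 0"
    "\<And>z. poly (cpoly h) z \<noteq> 0 \<Longrightarrow>
      poly (cpoly (pderiv h)) z / poly (cpoly h) z = (\<Sum>i<degree h. 1 / (z - of_real (r i)))"
proof -
  obtain r where r: "cpoly h = smult (lead_coeff (cpoly h)) (\<Prod>i<degree (cpoly h). [:- r i, 1:])"
    and root: "\<And>i. i < degree (cpoly h) \<Longrightarrow> poly (cpoly h) (r i) = 0"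
    and log: "\<And>z. poly (cpoly h) z \<noteq> 0 \<Longrightarrow> poly (pderiv (cpoly h)) z / poly (cpoly h) z =
      (\<Sum>i<degree (cpoly h). 1 / (z - r i))"
    by (rule logderiv_eq_sum[of "cpoly h"]) blast
  define \<rho> where "\<rho> = (\<lambda>i. Re (r i))"
  have r_eq: "r i = of_real (\<rho> i)" "\<rho> i < 0" if "i < degree h" for i
    using assms[OF root[of i]] that by (auto simp: degree_cpoly \<rho>_def complex_eq_iff)
  have prod: "cpoly (\<Prod>i<n. [:- \<rho> i, 1:]) = (\<Prod>i<n. [:- r i, 1:])" if "n \<le> degree h" for n
    using that
  proof (induction n)
    case 0
    show ?case by (rule poly_eqI) (simp add: coeff_map_poly coeff_1)
  next
    case (Suc n)
    then show ?case
      by (simp add: cpoly_mult cpoly_pCons r_eq del: mult_pCons_right)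
  qed
  have "cpoly (smult (lead_coeff h) (\<Prod>i<degree h. [:- \<rho> i, 1:])) =
      smult (lead_coeff (cpoly h)) (\<Prod>i<degree (cpoly h). [:- r i, 1:])"
    by (simp add: cpoly_smult prod degree_cpoly coeff_map_poly)
  also have "\<dots> = cpoly h" by (rule r[symmetric])
  finally have eq: "cpoly (smult (lead_coeff h) (\<Prod>i<degree h. [:- \<rho> i, 1:])) = cpoly h" .
  have h: "h = smult (lead_coeff h) (\<Prod>i<degree h. [:- \<rho> i, 1:])"
  proof (rule poly_eqI)
    fix k
    show "coeff h k = coeff (smult (lead_coeff h) (\<Prod>i<degree h. [:- \<rho> i, 1:])) k"
      using arg_cong[OF eq, of "\<lambda>p. coeff p k"]
      by (simp only: coeff_map_poly[of complex_of_real, OF of_real_0] of_real_eq_iff)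
  qed
  show ?thesis
  proof (rule that[OF h])
    show "\<rho> i < 0" if "i < degree h" for i using r_eq that by blast
    show "poly h (\<rho> i) = 0" if "i < degree h" for i
      using root[of i] that by (simp add: degree_cpoly r_eq poly_cpoly_of_real)
    show "poly (cpoly (pderiv h)) z / poly (cpoly h) z = (\<Sum>i<degree h. 1 / (z - of_real (\<rho> i)))"
      if "poly (cpoly h) z \<noteq> 0" for z
      using log[OF that] by (simp add: cpoly_pderiv degree_cpoly r_eq)
  qed
qed

text \<open>With \<theta>p = x p' this is p (\<theta>p)' - p' (\<theta>p), which is p^2
  (\<theta>p/p)' away from the zeros of p.\<close>

definition euler_wronskian :: "real poly \<Rightarrow> real poly" where
  "euler_wronskian p = p * pderiv p + pCons 0 (p * pderiv (pderiv p) - pderiv p * pderiv p)"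

text \<open>Reflects that \<theta>p/p is additive over products.\<close>

lemma euler_wronskian_mult:
  "poly (euler_wronskian (p * q)) x =
   poly (euler_wronskian p) x * (poly q x)\<^sup>2 + (poly p x)\<^sup>2 * poly (euler_wronskian q) x"
  by (simp add: euler_wronskian_def pderiv_mult pderiv_add power2_eq_square algebra_simps)

text \<open>A linear factor with root c contributes -c > 0, and the product rule preserves the
  sign.\<close>

lemma euler_wronskian_prod_pos:
  fixes r :: "nat \<Rightarrow> real"
  assumes "\<And>i. i < n \<Longrightarrow> r i < 0 \<and> x \<noteq> r i"
  shows "poly (euler_wronskian (\<Prod>i<n. [:- r i, 1:])) x \<ge> 0"
    and "n > 0 \<Longrightarrow> poly (euler_wronskian (\<Prod>i<n. [:- r i, 1:])) x > 0"
proof -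
  have lin: "poly (euler_wronskian [:- c, 1:]) x = - c" for c
    by (simp add: euler_wronskian_def pderiv_pCons)
  have nz: "poly (\<Prod>i<m. [:- r i, 1:]) x \<noteq> 0" if "m \<le> n" for m
  proof -
    have "x - r i \<noteq> 0" if "i < m" for i using assms[of i] order_less_le_trans[OF that \<open>m \<le> n\<close>] by simp
    then show ?thesis by (simp add: poly_prod)
  qed
  have step: "poly (euler_wronskian (\<Prod>i<Suc m. [:- r i, 1:])) x > 0"
    if "poly (euler_wronskian (\<Prod>i<m. [:- r i, 1:])) x \<ge> 0" "Suc m \<le> n" for m
  proof -
    have "(poly (\<Prod>i<m. [:- r i, 1:]) x)\<^sup>2 * (- r m) > 0"
      using assms[of m] that nz[of m] by (intro mult_pos_pos) auto
    moreover have "poly (euler_wronskian (\<Prod>i<m. [:- r i, 1:])) x * (poly [:- r m, 1:] x)\<^sup>2 \<ge> 0"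
      using that by simp
    ultimately show ?thesis
      unfolding prod.lessThan_Suc euler_wronskian_mult lin by linarith
  qed
  have ge: "poly (euler_wronskian (\<Prod>i<m. [:- r i, 1:])) x \<ge> 0" if "m \<le> n" for m
    using that
  proof (induction m)
    case 0
    show ?case by (simp add: euler_wronskian_def pderiv_1)
  next
    case (Suc m)
    then show ?case using step[of m] by simp
  qed
  show "poly (euler_wronskian (\<Prod>i<n. [:- r i, 1:])) x \<ge> 0" by (rule ge) simp
  show "poly (euler_wronskian (\<Prod>i<n. [:- r i, 1:])) x > 0" if "n > 0"
    using step[of "n - 1"] ge[of "n - 1"] that by simp
qed

text \<open>At a zero x of h the value is -x h'(x)^2, positive by simplicity and x < 0; elsewhere
  the factorization applies.\<close>

lemma euler_wronskian_pos:
  assumes h: "neg_simple_zeros h" "degree h > 0"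
  shows "poly (euler_wronskian h) x > 0"
proof (cases "poly h x = 0")
  case True
  then have "poly (cpoly h) (of_real x) = 0" by (simp add: poly_cpoly_of_real)
  then have "x < 0" "poly (pderiv h) x \<noteq> 0"
    using h(1)[unfolded neg_simple_zeros_def, rule_format, of "of_real x"]
    by (simp_all add: poly_cpoly_of_real)
  then have "- x * (poly (pderiv h) x)\<^sup>2 > 0" by (intro mult_pos_pos) auto
  then show ?thesis using True by (simp add: euler_wronskian_def power2_eq_square)
next
  case False
  have "Im z = 0 \<and> Re z < 0" if "poly (cpoly h) z = 0" for z
    using h(1) that by (auto simp: neg_simple_zeros_def)
  then obtain r where r: "h = smult (lead_coeff h) (\<Prod>i<degree h. [:- r i, 1:])"
    and neg: "\<And>i. i < degree h \<Longrightarrow> r i < 0" and root: "\<And>i. i < degree h \<Longrightarrow> poly h (r i) = 0"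
    using neg_real_zeros_factorization[of h] by metis
  have smult: "poly (euler_wronskian (smult c p)) x = c\<^sup>2 * poly (euler_wronskian p) x" for c p
    by (simp add: euler_wronskian_def pderiv_smult power2_eq_square algebra_simps)
  have "lead_coeff h \<noteq> 0" using h(2) by auto
  moreover have "poly (euler_wronskian (\<Prod>i<degree h. [:- r i, 1:])) x > 0"
    using neg root False h(2) by (intro euler_wronskian_prod_pos(2)) auto
  ultimately have "poly (euler_wronskian (smult (lead_coeff h) (\<Prod>i<degree h. [:- r i, 1:]))) x > 0"
    by (simp only: smult) simp
  then show ?thesis by (simp only: r[symmetric])
qed

text \<open>For c < 0 the imaginary part of z/(z - c) has the sign of Im z, so z h'/h, a sum of such
  terms, cannot equal the real number -a/b.\<close>

lemma euler_combination_nonzero_off_real: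
  assumes h: "neg_simple_zeros h" "degree h > 0" and "Im z \<noteq> 0" "b \<noteq> 0"
  shows "poly (cpoly (smult a h + smult b (pCons 0 (pderiv h)))) z \<noteq> 0"
proof
  assume 0: "poly (cpoly (smult a h + smult b (pCons 0 (pderiv h)))) z = 0"
  have neg: "Im z = 0 \<and> Re z < 0" if "poly (cpoly h) z = 0" for z
    using h(1) that by (auto simp: neg_simple_zeros_def)
  then obtain r where r: "\<And>i. i < degree h \<Longrightarrow> r i < 0" and
    log: "\<And>z. poly (cpoly h) z \<noteq> 0 \<Longrightarrow>
      poly (cpoly (pderiv h)) z / poly (cpoly h) z = (\<Sum>i<degree h. 1 / (z - of_real (r i)))"
    using neg_real_zeros_factorization[of h] by metis
  have hz: "poly (cpoly h) z \<noteq> 0" using neg \<open>Im z \<noteq> 0\<close> by blast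
  define q where "q = z * (poly (cpoly (pderiv h)) z / poly (cpoly h) z)"
  have q: "q = (\<Sum>i<degree h. z / (z - of_real (r i)))"
    unfolding q_def log[OF hz] by (simp add: sum_distrib_left)
  have Im: "Im (z / (z - of_real c)) = - c * Im z / ((Re z - c)\<^sup>2 + (Im z)\<^sup>2)" for c
    by (simp add: Im_divide algebra_simps)
  have "Im q * Im z = (\<Sum>i<degree h. - r i * (Im z)\<^sup>2 / ((Re z - r i)\<^sup>2 + (Im z)\<^sup>2))"
    unfolding q Im_sum sum_distrib_right Im by (simp add: power2_eq_square mult_ac)
  also have "\<dots> > 0"
    using h(2) r \<open>Im z \<noteq> 0\<close>
    by (intro sum_pos divide_pos_pos mult_pos_pos add_nonneg_pos) auto
  finally have "Im q \<noteq> 0" by auto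
  have "of_real a * poly (cpoly h) z + of_real b * (z * poly (cpoly (pderiv h)) z) = 0"
    using 0 by (simp add: cpoly_add cpoly_smult cpoly_pCons mult.left_commute)
  then have "of_real a + of_real b * q = 0"
    using hz by (simp add: q_def field_simps)
  then have "Im (of_real a + of_real b * q) = 0" by (simp only: zero_complex.sel)
  then show False using \<open>Im q \<noteq> 0\<close> \<open>b \<noteq> 0\<close> by simp
qed

text \<open>Rolle's theorem for f/g.\<close>

lemma wronskian_zero_between:
  fixes f g :: "real poly"
  assumes "x < y" "poly f x = 0" "poly f y = 0" "\<And>z. x \<le> z \<Longrightarrow> z \<le> y \<Longrightarrow> poly g z \<noteq> 0"
  shows "\<exists>z. poly (pderiv f) z * poly g z - poly f z * poly (pderiv g) z = 0"
proof -
  let ?q = "\<lambda>z. poly f z / poly g z"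
  let ?d = "\<lambda>z. (poly (pderiv f) z * poly g z - poly f z * poly (pderiv g) z) / (poly g z * poly g z)"
  have deriv: "DERIV ?q z :> ?d z" if "x < z" "z < y" for z
    using that assms(4)[of z] by (intro DERIV_divide poly_DERIV) auto
  have "\<exists>z. x < z \<and> z < y \<and> DERIV ?q z :> 0"
  proof (rule Rolle)
    show "x < y" "?q x = ?q y" using assms by auto
    show "continuous_on {x..y} ?q" using assms by (auto intro!: continuous_intros)
    show "?q differentiable (at z)" if "x < z" "z < y" for z
      using deriv[OF that] by (auto simp: real_differentiable_def)
  qed
  then obtain z where z: "x < z" "z < y" and "DERIV ?q z :> 0" by blast
  then have "?d z = 0" using deriv DERIV_unique by blast
  moreover have "poly g z \<noteq> 0" using z assms(4)[of z] by simp
  ultimately show ?thesis by auto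
qed

text \<open>Existence comes from Rolle for f/g; two zeros of g would contradict Rolle for g/f, since
  f has no zero between them.\<close>

lemma card_zeros_between:
  fixes f g :: "real poly"
  assumes W: "\<And>z. poly (pderiv f) z * poly g z - poly f z * poly (pderiv g) z \<noteq> 0"
    and "consecutive_zeros f x y"
  shows "card {z. x < z \<and> z < y \<and> poly g z = 0} = 1"
proof -
  have xy: "x < y" "poly f x = 0" "poly f y = 0" and nz: "\<And>z. x < z \<Longrightarrow> z < y \<Longrightarrow> poly f z \<noteq> 0"
    using assms(2) by (auto simp: consecutive_zeros_def)
  have W': "poly (pderiv g) z * poly f z - poly g z * poly (pderiv f) z \<noteq> 0" for z
    using W[of z] by (metis mult.commute right_minus_eq)
  have "\<exists>z. x \<le> z \<and> z \<le> y \<and> poly g z = 0"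
    using wronskian_zero_between[OF xy, of g] W by blast
  then obtain c where c: "x \<le> c" "c \<le> y" "poly g c = 0" by blast
  have "c \<noteq> x" "c \<noteq> y" using W[of c] c xy by auto
  with c have c': "x < c" "c < y" by auto
  have uniq: "\<not> (u < v)" if "x < u" "u < y" "poly g u = 0" "x < v" "v < y" "poly g v = 0" for u v
  proof
    assume "u < v"
    moreover have "poly f z \<noteq> 0" if "u \<le> z" "z \<le> v" for z
      using nz[of z] that \<open>x < u\<close> \<open>v < y\<close> by simp
    ultimately show False
      using wronskian_zero_between[of u v g f] that(3,6) W' by blast
  qed
  have "{z. x < z \<and> z < y \<and> poly g z = 0} = {c}"
  proof (intro equalityI subsetI)
    fix z assume "z \<in> {z. x < z \<and> z < y \<and> poly g z = 0}"
    then show "z \<in> {c}"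
      using uniq[of z c] uniq[of c z] c c' by auto
  qed (use c c' in auto)
  then show ?thesis by simp
qed

lemma all_zeros_real_simple_euler:
  assumes h: "neg_simple_zeros h" "degree h > 0" and "b \<noteq> 0"
    and f: "f = smult a h + smult b (pCons 0 (pderiv h))"
    and W: "\<And>z. poly (pderiv f) z * poly g z - poly f z * poly (pderiv g) z \<noteq> 0"
  shows "all_zeros_real_simple f"
proof -
  have real: "z \<in> \<real>" if "poly (cpoly f) z = 0" for z
    using euler_combination_nonzero_off_real[OF h _ \<open>b \<noteq> 0\<close>, of z a] that
    by (auto simp: f complex_is_Real_iff)
  have "f \<noteq> 0" using W by auto
  moreover have "rsquarefree (cpoly f)"
    unfolding rsquarefree_roots cpoly_pderiv
  proof (intro allI notI)
    fix z assume z: "poly (cpoly f) z = 0 \<and> poly (cpoly (pderiv f)) z = 0"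
    then obtain x where "z = of_real x" using real by (auto elim: Reals_cases)
    with z W[of x] show False by (simp add: poly_cpoly_of_real)
  qed
  ultimately show ?thesis using real by (simp add: all_zeros_real_simple_def)
qed

text \<open>The Wronskian is bilinear and alternating, so that of f and g is a nonzero multiple of
  \<open>euler_wronskian h\<close> and never vanishes.\<close>

theorem strictly_interlace_euler_combinations:
  assumes h: "neg_simple_zeros h" "degree h > 0" and b: "b \<noteq> 0" "d \<noteq> 0" and det: "a * d \<noteq> b * c"
    and f: "f = smult a h + smult b (pCons 0 (pderiv h))"
    and g: "g = smult c h + smult d (pCons 0 (pderiv h))"
  shows "strictly_interlace f g"
proof -
  have "poly (pderiv f) z * poly g z - poly f z * poly (pderiv g) z =
      (b * c - a * d) * poly (euler_wronskian h) z" for z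
    by (simp add: f g euler_wronskian_def pderiv_add pderiv_smult pderiv_pCons algebra_simps)
  then have W: "poly (pderiv f) z * poly g z - poly f z * poly (pderiv g) z \<noteq> 0" for z
    using euler_wronskian_pos[OF h, of z] det by simp
  then have W': "poly (pderiv g) z * poly f z - poly g z * poly (pderiv f) z \<noteq> 0" for z
    using W[of z] by (metis mult.commute right_minus_eq)
  show ?thesis
    unfolding strictly_interlace_def
  proof (intro conjI allI impI notI)
    show "all_zeros_real_simple f" by (rule all_zeros_real_simple_euler[OF h b(1) f W])
    show "all_zeros_real_simple g" by (rule all_zeros_real_simple_euler[OF h b(2) g W'])
    show False if "poly f x = 0 \<and> poly g x = 0" for x using that W[of x] by simp
    show "card {z. x < z \<and> z < y \<and> poly g z = 0} = 1" if "consecutive_zeros f x y" for x y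
      by (rule card_zeros_between[OF W that])
    show "card {z. x < z \<and> z < y \<and> poly f z = 0} = 1" if "consecutive_zeros g x y" for x y
      by (rule card_zeros_between[OF W' that])
  qed
qed


section \<open>The polynomials of the theorem\<close>

text \<open>Normalised to constant coefficient 1, so that polynomials with different parameters
  compare without prefactors.\<close>

definition jacobi_phi0 :: "real \<Rightarrow> real \<Rightarrow> nat \<Rightarrow> real poly" where
  "jacobi_phi0 \<alpha> \<beta> n = (\<Sum>k\<le>n div 2. monom (jacobi_coeff \<alpha> \<beta> n (2 * k) / 4 ^ k) k)"

lemma coeff_jacobi_phi0:
  "coeff (jacobi_phi0 \<alpha> \<beta> n) k = (if k \<le> n div 2 then jacobi_coeff \<alpha> \<beta> n (2 * k) / 4 ^ k else 0)"
  by (auto simp: jacobi_phi0_def coeff_sum coeff_monom)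

lemma jacobi_phi_conv_phi0:
  "jacobi_phi \<alpha> \<beta> n = smult (pochhammer (\<alpha> + 1) n / fact n) (jacobi_phi0 \<alpha> \<beta> n)"
  by (simp add: jacobi_phi_def jacobi_phi0_def jacobi_coeff_def)

lemma poly_cpoly_sum_monom:
  "poly (cpoly (\<Sum>k\<le>m. monom (c k) k)) z = (\<Sum>k\<le>m. of_real (c k) * z ^ k)"
proof (induction m)
  case (Suc m)
  then show ?case by (simp add: cpoly_add map_poly_monom poly_monom)
qed (simp add: map_poly_monom poly_monom)

lemma sum_even_odd:
  fixes f :: "nat \<Rightarrow> 'a :: comm_monoid_add"
  assumes "n > 0"
  shows "(\<Sum>j\<le>n. f j) = (\<Sum>k\<le>n div 2. f (2 * k)) + (\<Sum>k\<le>(n - 1) div 2. f (2 * k + 1))"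
  using assms
proof (induction n rule: nat_induct_non_zero)
  case (Suc n)
  show ?case
  proof (cases "even n")
    case True
    then obtain m where "n = 2 * m" by (elim evenE)
    with Suc obtain k where "n = 2 * Suc k" by (cases m) auto
    then show ?thesis using Suc.IH by (simp add: add_ac)
  next
    case False
    then obtain m where "n = 2 * m + 1" by (elim oddE)
    then show ?thesis using Suc.IH by (simp add: add_ac)
  qed
qed simp

text \<open>The substitution \<tau> = -s/2 turns stability for Re \<tau> \<le> 0 into that for Re s
  \<ge> 0; it produces the powers of 4 and the factor -1/2 in the odd part.\<close>

lemma hermite_biehler_jacobi:
  assumes "n > 0" "\<alpha> > -1" "real n + \<alpha> + \<beta> + 1 > 0"
    and stable: "\<And>\<tau>. Re \<tau> \<le> 0 \<Longrightarrow> (\<Sum>j\<le>n. \<tau> ^ j * of_real (jacobi_coeff \<alpha> \<beta> n j)) \<noteq> (0 :: complex)"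
  shows "neg_simple_zeros (jacobi_phi0 \<alpha> \<beta> n)"
    and "neg_simple_zeros (\<Sum>k\<le>(n - 1) div 2. monom (- jacobi_coeff \<alpha> \<beta> n (2 * k + 1) / 4 ^ k / 2) k)"
      (is "neg_simple_zeros ?d")
proof -
  have eval: "poly (cpoly (jacobi_phi0 \<alpha> \<beta> n)) (s\<^sup>2) + s * poly (cpoly ?d) (s\<^sup>2) =
      (\<Sum>j\<le>n. (- s / 2) ^ j * of_real (jacobi_coeff \<alpha> \<beta> n j))" for s :: complex
  proof -
    have "(4 :: complex) ^ k = 2 ^ (2 * k)" for k by (simp add: power_mult)
    then have "(- s / 2) ^ (2 * k) * of_real c = of_real (c / 4 ^ k) * (s\<^sup>2) ^ k"
      "(- s / 2) ^ (2 * k + 1) * of_real c = s * (of_real (- c / 4 ^ k / 2) * (s\<^sup>2) ^ k)" for k and c :: real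
      by (simp_all add: power_divide mult_ac flip: power_mult)
    then show ?thesis
      unfolding jacobi_phi0_def poly_cpoly_sum_monom sum_even_odd[OF \<open>n > 0\<close>] sum_distrib_left
      by simp
  qed
  have nz: "poly (cpoly (jacobi_phi0 \<alpha> \<beta> n)) (s\<^sup>2) + s * poly (cpoly ?d) (s\<^sup>2) \<noteq> 0" if "Re s \<ge> 0" for s
    unfolding eval by (rule stable) (use that in simp)
  have d0: "poly ?d 0 \<noteq> 0"
  proof -
    have "poly ?d 0 = - jacobi_coeff \<alpha> \<beta> n 1 / 2"
      by (simp add: poly_0_coeff_0 coeff_sum coeff_monom)
    then show ?thesis
      using jacobi_coeff_pos[OF assms(2,3), of 1] \<open>n > 0\<close> by simp
  qed
  show "neg_simple_zeros (jacobi_phi0 \<alpha> \<beta> n)"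
    by (rule hermite_biehler(1)[OF nz d0])
  show "neg_simple_zeros ?d"
    by (rule hermite_biehler(2)[OF nz d0])
qed

lemma neg_simple_zeros_jacobi_phi0:
  assumes "n \<ge> 3"
    and "(-1 < \<alpha> \<and> \<alpha> \<le> 0 \<and> -2 < \<beta>) \<or> (-1 < \<alpha> \<and> \<alpha> < 1 \<and> -1 < \<beta>) \<or> (1 \<le> \<alpha> \<and> \<alpha> < 2 \<and> 0 < \<beta>)"
  shows "neg_simple_zeros (jacobi_phi0 \<alpha> \<beta> n)"
  using assms(2)
proof (elim disjE conjE)
  assume "-1 < \<alpha>" "\<alpha> \<le> 0" "-2 < \<beta>"
  then show ?thesis
    using assms(1) by (intro hermite_biehler_jacobi(1) jacobi_stable_nonpos_alpha) auto
next
  assume "-1 < \<alpha>" "\<alpha> < 1" "-1 < \<beta>"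
  then show ?thesis
    using assms(1) by (intro hermite_biehler_jacobi(1) jacobi_stable_small_alpha) auto
next
  assume a: "1 \<le> \<alpha>" "\<alpha> < 2" "0 < \<beta>"
  define N where "N = real n + \<alpha> + \<beta>"
  have "N > 0" "\<alpha> \<noteq> 0" using a by (auto simp: N_def)
  \<comment> \<open>Splitting off the first factor of each Pochhammer symbol identifies the odd part
    for the lowered parameters with a multiple of
    \<open>jacobi_phi0 \<alpha> \<beta> n\<close>.\<close>
  have "jacobi_coeff (\<alpha> - 1) (\<beta> - 1) (Suc n) (2 * k + 1) =
      - (real (Suc n) * N / \<alpha>) * jacobi_coeff \<alpha> \<beta> n (2 * k)" for k
  proof -
    have "- real (Suc n) + 1 = - real n" "real (Suc n) + (\<alpha> - 1) + (\<beta> - 1) + 1 = N"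
      "real n + \<alpha> + \<beta> + 1 = N + 1" "\<alpha> - 1 + 1 = \<alpha>"
      by (simp_all add: N_def)
    then show ?thesis
      unfolding jacobi_coeff_def Suc_eq_plus1[symmetric] pochhammer_rec by (simp only:) (simp del: of_nat_Suc)
  qed
  then have "(\<Sum>k\<le>(Suc n - 1) div 2. monom (- jacobi_coeff (\<alpha> - 1) (\<beta> - 1) (Suc n) (2 * k + 1) / 4 ^ k / 2) k) =
     smult (real (Suc n) * N / \<alpha> / 2) (jacobi_phi0 \<alpha> \<beta> n)"
    by (intro poly_eqI) (auto simp: coeff_jacobi_phi0 coeff_sum coeff_monom)
  moreover have "neg_simple_zeros (\<Sum>k\<le>(Suc n - 1) div 2.
      monom (- jacobi_coeff (\<alpha> - 1) (\<beta> - 1) (Suc n) (2 * k + 1) / 4 ^ k / 2) k)"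
    using a by (intro hermite_biehler_jacobi(2) jacobi_stable_small_alpha) auto
  moreover have "real (Suc n) * N / \<alpha> / 2 \<noteq> 0" using \<open>N > 0\<close> \<open>\<alpha> \<noteq> 0\<close> by simp
  ultimately show ?thesis using neg_simple_zeros_smult by metis
qed

lemma degree_jacobi_phi0_pos:
  assumes "n \<ge> 2" "\<alpha> > -1" "real n + \<alpha> + \<beta> + 1 > 0"
  shows "degree (jacobi_phi0 \<alpha> \<beta> n) > 0"
proof -
  have "coeff (jacobi_phi0 \<alpha> \<beta> n) 1 \<noteq> 0"
    using jacobi_coeff_pos[OF assms(2,3), of 2] assms(1) by (simp add: coeff_jacobi_phi0)
  then have "1 \<le> degree (jacobi_phi0 \<alpha> \<beta> n)" by (rule le_degree)
  then show ?thesis by simp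
qed

text \<open>\<theta> multiplies the k-th coefficient by k, and raising \<beta> by 1 multiplies it by
  1 + 2k/N.\<close>

lemma jacobi_phi0_raise_beta:
  fixes n :: nat and \<alpha> \<beta> :: real
  defines "N \<equiv> real n + \<alpha> + \<beta>"
  assumes "N \<noteq> 0"
  shows "jacobi_phi0 \<alpha> \<beta> n = smult 1 (jacobi_phi0 \<alpha> (\<beta> - 1) n) +
    smult (2 / N) (pCons 0 (pderiv (jacobi_phi0 \<alpha> (\<beta> - 1) n)))"
proof (rule poly_eqI)
  fix k
  let ?h = "jacobi_phi0 \<alpha> (\<beta> - 1) n"
  have "N * pochhammer (N + 1) (2 * k) = pochhammer N (2 * k) * (N + 2 * real k)"
    using pochhammer_rec[of N "2 * k"] pochhammer_Suc[of N "2 * k"] by simp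
  then have "pochhammer (N + 1) (2 * k) = pochhammer N (2 * k) * (1 + 2 * real k / N)"
    using \<open>N \<noteq> 0\<close> by (simp add: divide_simps) (simp add: algebra_simps)
  then have "jacobi_coeff \<alpha> \<beta> n (2 * k) = jacobi_coeff \<alpha> (\<beta> - 1) n (2 * k) * (1 + 2 * real k / N)"
    by (simp add: jacobi_coeff_def N_def add_ac)
  moreover have "coeff (pCons 0 (pderiv ?h)) k = real k * coeff ?h k"
    by (cases k) (simp_all add: coeff_pderiv)
  ultimately show "coeff (jacobi_phi0 \<alpha> \<beta> n) k = coeff (smult 1 ?h + smult (2 / N) (pCons 0 (pderiv ?h))) k"
    by (simp only: coeff_add coeff_smult) (simp add: coeff_jacobi_phi0 ring_distribs add_divide_distrib mult_ac)
qed

text \<open>The sum of degree and \<beta> is unchanged, so only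
  \<open>pochhammer (- real n) (2*k)\<close> changes, by the factor 1 - 2k/n.\<close>

lemma jacobi_phi0_lower_degree:
  assumes "n > 0"
  shows "jacobi_phi0 \<alpha> \<beta> (n - 1) = smult 1 (jacobi_phi0 \<alpha> (\<beta> - 1) n) +
    smult (- 2 / real n) (pCons 0 (pderiv (jacobi_phi0 \<alpha> (\<beta> - 1) n)))"
proof (rule poly_eqI)
  fix k
  let ?h = "jacobi_phi0 \<alpha> (\<beta> - 1) n"
  define m where "m = - real n"
  have m: "m \<noteq> 0" "- real (n - 1) = m + 1" using assms by (auto simp: m_def)
  have "m * pochhammer (m + 1) (2 * k) = pochhammer m (2 * k) * (m + 2 * real k)"
    using pochhammer_rec[of m "2 * k"] pochhammer_Suc[of m "2 * k"] by simp
  then have "pochhammer (m + 1) (2 * k) = pochhammer m (2 * k) * (1 + 2 * real k / m)"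
    using m by (simp add: divide_simps) (simp add: algebra_simps)
  moreover have "real (n - 1) + \<alpha> + \<beta> + 1 = real n + \<alpha> + (\<beta> - 1) + 1" using assms by simp
  ultimately have *: "jacobi_coeff \<alpha> \<beta> (n - 1) (2 * k) = jacobi_coeff \<alpha> (\<beta> - 1) n (2 * k) * (1 + 2 * real k / m)"
    unfolding jacobi_coeff_def m(2) by (simp add: m_def)
  \<comment> \<open>For even n the right side has one more coefficient, at k = n/2; the factor is
    zero exactly there.\<close>
  have zero: "1 + 2 * real k / m = 0" if "k \<le> n div 2" "\<not> k \<le> (n - 1) div 2"
  proof -
    have "n = 2 * k" using that by presburger
    then show ?thesis using m by (simp add: m_def)
  qed
  have "coeff (pCons 0 (pderiv ?h)) k = real k * coeff ?h k"
    by (cases k) (simp_all add: coeff_pderiv)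
  then have "coeff (smult 1 ?h + smult (- 2 / real n) (pCons 0 (pderiv ?h))) k = coeff ?h k * (1 + 2 * real k / m)"
    by (simp only: coeff_add coeff_smult) (simp add: m_def ring_distribs)
  also have "\<dots> = coeff (jacobi_phi0 \<alpha> \<beta> (n - 1)) k"
  proof (cases "k \<le> (n - 1) div 2")
    case True
    then have "k \<le> n div 2" by linarith
    with True show ?thesis using * by (simp add: coeff_jacobi_phi0)
  next
    case False
    then show ?thesis using zero by (auto simp: coeff_jacobi_phi0)
  qed
  finally show "coeff (jacobi_phi0 \<alpha> \<beta> (n - 1)) k =
     coeff (smult 1 ?h + smult (- 2 / real n) (pCons 0 (pderiv ?h))) k" by simp
qed

theorem mainTheorem4:
  fixes n :: nat and \<alpha> \<beta> :: real
  assumes "n \<ge> 4"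
    and "(-1 < \<alpha> \<and> \<alpha> < 0 \<and> -1 < \<beta>) \<or> (0 \<le> \<alpha> \<and> \<alpha> < 1 \<and> 0 < \<beta>) \<or> (1 \<le> \<alpha> \<and> \<alpha> < 2 \<and> 1 < \<beta>)"
  shows "strictly_interlace (jacobi_phi \<alpha> \<beta> n) (jacobi_phi \<alpha> \<beta> (n - 1))"
proof -
  define h where "h = jacobi_phi0 \<alpha> (\<beta> - 1) n"
  define N where "N = real n + \<alpha> + \<beta>"
  have \<alpha>: "\<alpha> > -1" and "N > 0" using assms by (auto simp: N_def)
  define c1 where "c1 = pochhammer (\<alpha> + 1) n / fact n"
  define c2 where "c2 = pochhammer (\<alpha> + 1) (n - 1) / fact (n - 1)"
  have c: "c1 > 0" "c2 > 0" using \<alpha> by (auto simp: c1_def c2_def intro!: pochhammer_pos divide_pos_pos)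
  have f: "jacobi_phi \<alpha> \<beta> n = smult c1 h + smult (c1 * (2 / N)) (pCons 0 (pderiv h))"
    using jacobi_phi0_raise_beta[of n \<alpha> \<beta>] \<open>N > 0\<close>
    by (simp add: jacobi_phi_conv_phi0 h_def N_def c1_def smult_add_right)
  have g: "jacobi_phi \<alpha> \<beta> (n - 1) = smult c2 h + smult (c2 * (- 2 / real n)) (pCons 0 (pderiv h))"
    using jacobi_phi0_lower_degree[of n \<alpha> \<beta>] assms(1)
    by (simp add: jacobi_phi_conv_phi0 h_def c2_def smult_add_right)
  \<comment> \<open>The three parameter ranges, with \<beta> lowered by 1, are covered by the three
    cases of \<open>neg_simple_zeros_jacobi_phi0\<close>.\<close>
  have "neg_simple_zeros h"
    unfolding h_def by (rule neg_simple_zeros_jacobi_phi0) (use assms in auto)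
  moreover have "degree h > 0"
    unfolding h_def by (rule degree_jacobi_phi0_pos) (use assms in auto)
  moreover have b: "c1 * (2 / N) > 0" "c2 * (- 2 / real n) < 0"
    using c \<open>N > 0\<close> assms(1) by (auto simp: mult_pos_neg divide_neg_pos)
  \<comment> \<open>The derivative terms have opposite signs, so the determinant of the two
    combinations is nonzero.\<close>
  moreover have "c1 * (c2 * (- 2 / real n)) < c1 * (2 / N) * c2"
    using mult_pos_neg[OF c(1) b(2)] mult_pos_pos[OF b(1) c(2)] by linarith
  ultimately show ?thesis
    using assms(1) by (intro strictly_interlace_euler_combinations[OF _ _ _ _ _ f g]) auto
qed

end
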